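(* Let $m,n,k,l\in\mathbb N$ with $m\equiv n\pmod 2$ and $k\equiv l\pmod 2$, and let $\sigma\in\mathcal B_{nm}$ and $\tau\in\mathcal B_{lk}$ with $r=\operatorname{rank}(\sigma)$ and $s=\operatorname{rank}(\tau)$. Then the sandwich semigroups $\mathcal B_{mn}^\sigma$ and $\mathcal B_{kl}^\tau$ are isomorphic if and only if one of the following holds: (i) $(m,n,r)=(k,l,s)$; (ii) $m+n\leq 2$ and $k+l\leq 2$; (iii) after interchanging $(m,n,r)$ and $(k,l,s)$ if necessary, $(m,n,r)=(2q,0,0)$ and $(k,l,s)=(2q-1,1,1)$ for some positive integer $q$; (iv) after interchanging $(m,n,r)$ and $(k,l,s)$ if necessary, $(m,n,r)=(0,2q,0)$ and $(k,l,s)=(1,2q-1,1)$ for some positive integer $q$.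
   Context: $\mathbb N=\{0,1,2,\ldots\}$, $[n]=\{1,\ldots,n\}$ (with $[0]=\emptyset$), and $A'=\{a':a\in A\}$, $A''=\{a'':a\in A\}$ for $A\subseteq\mathbb N$. For $m,n\in\mathbb N$, $\mathcal B_{mn}$ is the set of all Brauer partitions, i.e. set partitions of $[m]\cup[n]'$ into blocks of size $2$ (for $m=n=0$, the empty partition is the unique element). For $\alpha\in\mathcal B_{mn}$ and $\beta\in\mathcal B_{nk}$, the product $\alpha\beta\in\mathcal B_{mk}$ is formed as follows: view partitions as graphs whose connected components are the blocks; let $\alpha_\downarrow$ be the graph on $[m]\cup[n]''$ obtained from $\alpha$ by renaming each $x'$ to $x''$, let $\beta^\uparrow$ be the graph on $[n]''\cup[k]'$ obtained from $\beta$ by renaming each $x\in[n]$ to $x''$, and let $\Pi(\alpha,\beta)$ be the union of these graphs on $[m]\cup[n]''\cup[k]'$; two elements of $[m]\cup[k]'$ lie in the same block of $\alpha\beta$ iff they lie in the same connected component of $\Pi(\alpha,\beta)$. This makes $\mathcal B=\bigcup_{m,n}\mathcal B_{mn}$ a category with object set $\mathbb N$. The rank of $\alpha\in\mathcal B_{mn}$ is the number of blocks of $\alpha$ meeting both $[m]$ and $[n]'$. For $\sigma\in\mathcal B_{nm}$, the sandwich semigroup $\mathcal B_{mn}^\sigma$ is the set $\mathcal B_{mn}$ with the associative operation $\alpha\star_\sigma\beta=\alpha\sigma\beta$. *)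

theory Defs
  imports Main "HOL-Library.Disjoint_Sets"
begin

text \<open>The vertices \<open>x\<close>, \<open>x'\<close> and \<open>x''\<close>, respectively.\<close>
datatype vertex = Unprimed nat | Primed nat | Dprimed nat

definition vertices :: "nat \<Rightarrow> nat \<Rightarrow> vertex set" where
  "vertices m n = Unprimed ` {1..m} \<union> Primed ` {1..n}"

definition brauer :: "nat \<Rightarrow> nat \<Rightarrow> vertex set set set" where
  "brauer m n = {\<alpha>. partition_on (vertices m n) \<alpha> \<and> (\<forall>A\<in>\<alpha>. card A = 2)}"

definition brauer_rank :: "nat \<Rightarrow> nat \<Rightarrow> vertex set set \<Rightarrow> nat" where
  "brauer_rank m n \<alpha> =
     card {A \<in> \<alpha>. A \<inter> Unprimed ` {1..m} \<noteq> {} \<and> A \<inter> Primed ` {1..n} \<noteq> {}}"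

fun lower_to_mid :: "vertex \<Rightarrow> vertex" where
  "lower_to_mid (Primed x) = Dprimed x"
| "lower_to_mid v = v"

fun upper_to_mid :: "vertex \<Rightarrow> vertex" where
  "upper_to_mid (Unprimed x) = Dprimed x"
| "upper_to_mid v = v"

text \<open>The edge relation of the product graph \<open>\<Pi>(\<alpha>, \<beta>)\<close>. A partition is viewed as the graph in
  which each block is a complete graph; loops are included, which does not affect connectivity.\<close>
definition product_graph :: "vertex set set \<Rightarrow> vertex set set \<Rightarrow> (vertex \<times> vertex) set" where
  "product_graph \<alpha> \<beta> =
     (\<Union>A \<in> (image lower_to_mid) ` \<alpha> \<union> (image upper_to_mid) ` \<beta>. A \<times> A)"

text \<open>For \<open>\<alpha> \<in> brauer m n\<close> and \<open>\<beta> \<in> brauer n k\<close>; the middle index \<open>n\<close> is not needed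
  as an argument, since the edges determine all paths.\<close>
definition brauer_mult ::
  "nat \<Rightarrow> nat \<Rightarrow> vertex set set \<Rightarrow> vertex set set \<Rightarrow> vertex set set" where
  "brauer_mult m k \<alpha> \<beta> =
     vertices m k // {(x, y) \<in> vertices m k \<times> vertices m k. (x, y) \<in> (product_graph \<alpha> \<beta>)\<^sup>*}"

text \<open>For \<open>\<alpha>, \<beta> \<in> brauer m n\<close> and \<open>\<sigma> \<in> brauer n m\<close>, so that \<open>\<alpha>\<sigma> \<in> brauer m m\<close>.\<close>
definition sandwich_mult ::
  "nat \<Rightarrow> nat \<Rightarrow> vertex set set \<Rightarrow> vertex set set \<Rightarrow> vertex set set \<Rightarrow> vertex set set" where
  "sandwich_mult m n \<sigma> \<alpha> \<beta> = brauer_mult m n (brauer_mult m m \<alpha> \<sigma>) \<beta>"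

definition semigroups_isomorphic ::
  "'a set \<Rightarrow> ('a \<Rightarrow> 'a \<Rightarrow> 'a) \<Rightarrow> 'b set \<Rightarrow> ('b \<Rightarrow> 'b \<Rightarrow> 'b) \<Rightarrow> bool" where
  "semigroups_isomorphic S f T g \<longleftrightarrow>
     (\<exists>\<phi>. bij_betw \<phi> S T \<and> (\<forall>x\<in>S. \<forall>y\<in>S. \<phi> (f x y) = g (\<phi> x) (\<phi> y)))"

end

theory Submission imports Defs begin

text \<open>
  A Brauer partition is a perfect matching, and its blocks are upper hooks, lower hooks and
  transversals. A product \<open>\<alpha>\<sigma>\<beta>\<close> contains the upper hooks of \<open>\<alpha>\<close> and the lower hooks of \<open>\<beta>\<close>, and the
  rank of a partition is determined by the number of its upper hooks, or of its lower hooks. Together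
  with the fact that a product is again a Brauer partition (in the union of two matchings, the
  component of an outer vertex is a path, \<open>two_ends_of_component\<close>), these observations carry most of the
  computations, and associativity is never needed.

  An isomorphism preserves four numbers (\<open>isomorphic_sandwich_invariants\<close>). The semigroup has
  \<open>(m + n - 1)!!\<close> elements. The elements \<open>\<alpha>\<close> of rank at most one are those satisfying \<open>\<alpha>\<beta>\<alpha> = \<alpha>\<close> for
  all \<open>\<beta>\<close>, where products are taken in the sandwich semigroup (\<open>sandwich_low_rank_iff\<close>); the right
  ideal and the left ideal generated by such an element have \<open>(n' - 1)!!\<close> and \<open>(m' - 1)!!\<close> elements,
  where \<open>m'\<close> and \<open>n'\<close> arise from \<open>m\<close> and \<open>n\<close> by rounding up to an even number. As \<open>(j - 1)!!\<close>
  is injective on the even numbers \<open>j \<ge> 2\<close>, with the same value at \<open>0\<close> and \<open>2\<close>, these three numbers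
  determine \<open>m\<close> and \<open>n\<close>, except when both semigroups are trivial or belong to one of the two
  exceptional families. Finally, the set of all products consists of the elements whose rank is at most
  \<open>r\<close> (\<open>sandwich_products\<close>), and its size determines \<open>r\<close>.

  Conversely, sandwich elements of equal rank differ by a renaming of the vertices, which induces an
  isomorphism (\<open>sandwich_isomorphic_of_same_rank\<close>). In the exceptional families both semigroups are left
  zero semigroups, or both are right zero semigroups, and they have the same size.
\<close>

section \<open>Perfect matchings\<close>

text \<open>Perfect matchings of a vertex set, encoded as sets of two-element blocks; a Brauer partition is a
  perfect matching of \<open>vertices m n\<close>.\<close>
definition matchings :: "'a set \<Rightarrow> 'a set set set" where
  "matchings V = {P. partition_on V P \<and> (\<forall>A\<in>P. card A = 2)}"

lemma brauer_eq_matchings: "brauer m n = matchings (vertices m n)"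
  by (simp add: brauer_def matchings_def)

lemma matchings_iff:
  "P \<in> matchings V \<longleftrightarrow>
     \<Union>P = V \<and> (\<forall>A\<in>P. \<forall>B\<in>P. A \<noteq> B \<longrightarrow> A \<inter> B = {}) \<and> (\<forall>A\<in>P. card A = 2)"
  by (force simp: matchings_def partition_on_def disjoint_def)

lemma matchingsI:
  assumes "\<Union>P = V" "\<And>A B. A \<in> P \<Longrightarrow> B \<in> P \<Longrightarrow> A \<noteq> B \<Longrightarrow> A \<inter> B = {}" "\<And>A. A \<in> P \<Longrightarrow> card A = 2"
  shows "P \<in> matchings V"
  using assms by (simp add: matchings_iff)

lemma matchings_Union: "P \<in> matchings V \<Longrightarrow> \<Union>P = V"
  by (simp add: matchings_iff)

lemma matchings_disjoint: "P \<in> matchings V \<Longrightarrow> A \<in> P \<Longrightarrow> B \<in> P \<Longrightarrow> x \<in> A \<Longrightarrow> x \<in> B \<Longrightarrow> A = B"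
  by (auto simp: matchings_iff)

lemma matchings_card_block: "P \<in> matchings V \<Longrightarrow> A \<in> P \<Longrightarrow> card A = 2"
  by (simp add: matchings_iff)

lemma matchings_blockE:
  assumes "P \<in> matchings V" "A \<in> P"
  obtains x y where "A = {x, y}" "x \<noteq> y" "x \<in> V" "y \<in> V"
proof -
  obtain x y where "A = {x, y}" "x \<noteq> y"
    using matchings_card_block[OF assms] by (auto simp: card_2_iff)
  with matchings_Union[OF assms(1)] assms(2) that show ?thesis by blast
qed

lemma matchings_pairE:
  assumes "P \<in> matchings V" "x \<in> V"
  obtains y where "{x, y} \<in> P" "x \<noteq> y" "y \<in> V"
proof -
  obtain A where A: "A \<in> P" "x \<in> A" using matchings_Union[OF assms(1)] assms(2) by auto
  then show ?thesis
    using matchings_blockE[OF assms(1) A(1)] that by (metis insert_commute insertE singletonD)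
qed

lemma matchings_subset_Pow: "matchings V \<subseteq> Pow (Pow V)"
  by (auto simp: matchings_iff)

lemma finite_matchings: "finite V \<Longrightarrow> finite (matchings V)"
  by (rule finite_subset[OF matchings_subset_Pow]) simp

lemma matchings_finite: "finite V \<Longrightarrow> P \<in> matchings V \<Longrightarrow> finite P"
  using matchings_subset_Pow by (metis PowD finite_Pow_iff finite_subset subsetD)

lemma matchings_card:
  assumes "finite V" "P \<in> matchings V"
  shows "card V = 2 * card P"
proof -
  have "2 * card P = card (\<Union>P)"
  proof (rule card_partition)
    show "finite P" "finite (\<Union>P)"
      using assms matchings_finite by (auto simp: matchings_iff)
  qed (use assms in \<open>auto simp: matchings_iff\<close>)
  then show ?thesis using assms by (simp add: matchings_iff)
qed

lemma matchings_subset_eq: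
  assumes "P \<in> matchings V" "Q \<in> matchings V" "P \<subseteq> Q"
  shows "P = Q"
proof
  show "Q \<subseteq> P"
  proof
    fix A assume A: "A \<in> Q"
    then obtain x where x: "x \<in> A" "x \<in> V" using matchings_blockE[OF assms(2)] by blast
    then obtain B where "B \<in> P" "x \<in> B" using matchings_Union[OF assms(1)] by auto
    with A x assms(2,3) show "A \<in> P" using matchings_disjoint by (metis subsetD)
  qed
qed fact

lemma matchings_subfamily: "P \<in> matchings V \<Longrightarrow> Q \<subseteq> P \<Longrightarrow> Q \<in> matchings (\<Union>Q)"
  by (auto simp: matchings_iff)

lemma matchings_Un:
  assumes "P \<in> matchings V" "Q \<in> matchings W" "V \<inter> W = {}"
  shows "P \<union> Q \<in> matchings (V \<union> W)"
proof (rule matchingsI)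
  show "\<Union>(P \<union> Q) = V \<union> W" using assms by (auto simp: matchings_iff)
  show "A \<inter> B = {}" if "A \<in> P \<union> Q" "B \<in> P \<union> Q" "A \<noteq> B" for A B
    using that assms(3) matchings_Union[OF assms(1)] matchings_Union[OF assms(2)]
      matchings_disjoint[OF assms(1)] matchings_disjoint[OF assms(2)] by blast
qed (use assms in \<open>auto simp: matchings_iff\<close>)

lemma matchings_Diff:
  assumes "P \<in> matchings V" "Q \<subseteq> P"
  shows "P - Q \<in> matchings (V - \<Union>Q)"
proof (rule matchingsI)
  show "\<Union>(P - Q) = V - \<Union>Q"
  proof
    show "\<Union>(P - Q) \<subseteq> V - \<Union>Q"
      using assms matchings_disjoint[OF assms(1)] matchings_Union[OF assms(1)] by blast
    show "V - \<Union>Q \<subseteq> \<Union>(P - Q)"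
      using matchings_Union[OF assms(1)] by blast
  qed
qed (use assms in \<open>auto simp: matchings_iff\<close>)

lemma matchings_image:
  assumes "P \<in> matchings V" "inj_on f V"
  shows "image f ` P \<in> matchings (f ` V)"
proof (rule matchingsI)
  note U = matchings_Union[OF assms(1)]
  show "\<Union>(image f ` P) = f ` V" using U by blast
  fix A assume "A \<in> image f ` P"
  then obtain A' where A': "A' \<in> P" "A = f ` A'" by blast
  have "A' \<subseteq> V" using A' U by blast
  then show "card A = 2"
    using A' matchings_card_block[OF assms(1)] assms(2) by (metis card_image inj_on_subset)
  fix B assume "B \<in> image f ` P" "A \<noteq> B"
  then obtain B' where B': "B' \<in> P" "B = f ` B'" "A' \<noteq> B'" using A' by blast
  then show "A \<inter> B = {}"
    using A' matchings_disjoint[OF assms(1)] assms(2) U unfolding inj_on_def by blast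
qed

lemma matchings_doubleton: "x \<noteq> y \<Longrightarrow> {{x, y}} \<in> matchings {x, y}"
  by (rule matchingsI) auto

text \<open>The perfect matchings containing a given matching of a subset are the extensions by a
  perfect matching of the complement.\<close>
lemma bij_betw_matchings_containing:
  assumes "P \<in> matchings W" "W \<subseteq> V"
  shows "bij_betw (\<lambda>Q. P \<union> Q) (matchings (V - W)) {Q \<in> matchings V. P \<subseteq> Q}"
proof (rule bij_betwI[where g = "\<lambda>Q. Q - P"])
  show "(\<lambda>Q. P \<union> Q) \<in> matchings (V - W) \<rightarrow> {Q \<in> matchings V. P \<subseteq> Q}"
  proof
    fix Q assume "Q \<in> matchings (V - W)"
    then have "P \<union> Q \<in> matchings (W \<union> (V - W))" using assms by (intro matchings_Un) auto
    then show "P \<union> Q \<in> {Q \<in> matchings V. P \<subseteq> Q}" using assms by (simp add: Un_absorb1)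
  qed
  show "(\<lambda>Q. Q - P) \<in> {Q \<in> matchings V. P \<subseteq> Q} \<rightarrow> matchings (V - W)"
    using assms matchings_Diff[where Q = P] by (auto simp: matchings_Union[OF assms(1)])
  show "P \<union> Q - P = Q" if "Q \<in> matchings (V - W)" for Q
  proof -
    have "P \<inter> Q = {}"
    proof (rule ccontr)
      assume "P \<inter> Q \<noteq> {}"
      then obtain A where A: "A \<in> P" "A \<in> Q" by blast
      obtain x where "x \<in> A" using matchings_blockE[OF assms(1) A(1)] by blast
      then show False using A matchings_Union[OF assms(1)] matchings_Union[OF that] by blast
    qed
    then show ?thesis by blast
  qed
qed auto

text \<open>The number of perfect matchings of a set with \<open>n\<close> elements; it is \<open>(n - 1)!!\<close> for even \<open>n\<close>.\<close>
fun num_matchings :: "nat \<Rightarrow> nat" where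
  "num_matchings 0 = 1"
| "num_matchings (Suc 0) = 0"
| "num_matchings (Suc (Suc n)) = Suc n * num_matchings n"

lemma card_matchings:
  assumes "finite V"
  shows "card (matchings V) = num_matchings (card V)"
  using assms
proof (induction "card V" arbitrary: V rule: num_matchings.induct)
  case 1
  then have "matchings V = {{}}" by (auto simp: matchings_def partition_on_empty)
  then show ?case using 1 by simp
next
  case 2
  have "matchings V = {}"
    using matchings_card[OF 2(2)] 2(1) by (metis Suc_1 all_not_in_conv dvd_triv_left odd_one One_nat_def)
  then show ?case using 2(1)[symmetric] by simp
next
  case (3 n)
  then obtain v where v: "v \<in> V" by fastforce
  let ?C = "\<lambda>w. {Q \<in> matchings V. {{v, w}} \<subseteq> Q}"
  have C: "card (?C w) = num_matchings n" if "w \<in> V - {v}" for w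
  proof -
    have "card (?C w) = card (matchings (V - {v, w}))"
      using bij_betw_matchings_containing[OF matchings_doubleton, of v w V] v that
      by (metis (no_types, lifting) DiffD1 DiffD2 bij_betw_same_card empty_subsetI insert_subset singletonI)
    moreover have "card (V - {v, w}) = n"
      using that v 3(2)[symmetric] 3(3) by (auto simp add: card_Diff_subset card_insert_if)
    ultimately show ?thesis using 3 by simp
  qed
  have "matchings V = (\<Union>w\<in>V - {v}. ?C w)"
  proof
    show "matchings V \<subseteq> (\<Union>w\<in>V - {v}. ?C w)"
    proof
      fix Q assume Q: "Q \<in> matchings V"
      then obtain w where "{v, w} \<in> Q" "v \<noteq> w" "w \<in> V" using v by (rule matchings_pairE)
      with Q show "Q \<in> (\<Union>w\<in>V - {v}. ?C w)" by blast
    qed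
  qed blast
  also have "card \<dots> = (\<Sum>w\<in>V - {v}. card (?C w))"
  proof (rule card_UN_disjoint)
    show "\<forall>i\<in>V - {v}. \<forall>j\<in>V - {v}. i \<noteq> j \<longrightarrow> ?C i \<inter> ?C j = {}"
    proof (intro ballI impI)
      fix i j assume "i \<in> V - {v}" "j \<in> V - {v}" "i \<noteq> j"
      then have "{v, i} \<noteq> {v, j}" by (auto simp: doubleton_eq_iff)
      then show "?C i \<inter> ?C j = {}" using matchings_disjoint[of _ V "{v, i}" "{v, j}" v] by auto
    qed
  qed (use finite_matchings[OF 3(3)] 3(3) in \<open>auto intro: finite_subset\<close>)
  also have "\<dots> = Suc n * num_matchings n"
    using C v 3(2)[symmetric] 3(3) by simp
  finally show ?case using 3(2)[symmetric] by simp
qed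

lemma num_matchings_pos: "even n \<Longrightarrow> num_matchings n > 0"
  by (induction n rule: num_matchings.induct) auto

lemma num_matchings_strict_mono:
  assumes "even n" "2 \<le> n" "even n'" "n < n'"
  shows "num_matchings n < num_matchings n'"
proof -
  obtain i where i: "n = 2 * i" using assms by (auto elim: evenE)
  obtain j where j: "n' = 2 * j" using assms by (auto elim: evenE)
  have step: "num_matchings (2 * k) < num_matchings (2 * Suc k)" if "k \<ge> i" for k
    using num_matchings_pos[of "2 * k"] that assms(2) i by simp
  have "num_matchings (2 * i) < num_matchings (2 * (i + d))" if "d > 0" for d
    using that
  proof (induction d)
    case (Suc d)
    then show ?case using step[of "i + d"] by (cases "d = 0") (auto simp del: num_matchings.simps)
  qed simp
  from this[of "j - i"] show ?thesis using i j assms(4) by simp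
qed

lemma num_matchings_eqD:
  assumes "num_matchings n = num_matchings n'" "even n" "even n'"
  shows "n = n' \<or> (n \<le> 2 \<and> n' \<le> 2)"
proof (rule ccontr)
  have two: "num_matchings 2 = 1" by (simp add: numeral_2_eq_2)
  have small: "num_matchings a = num_matchings (max a 2)" if "even a" for a
  proof (cases "a \<ge> 2")
    case False
    then have "a = 0" using that by (metis One_nat_def less_2_cases not_le odd_one)
    then show ?thesis using two by simp
  qed (simp add: max_absorb1)
  assume "\<not> ?thesis"
  then have "max n 2 \<noteq> max n' 2" by auto
  moreover have "even (max n 2)" "even (max n' 2)" using assms by (auto simp: max_def)
  ultimately show False
    using num_matchings_strict_mono[of "max n 2" "max n' 2"]
      num_matchings_strict_mono[of "max n' 2" "max n 2"] assms small[of n] small[of n']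
    by (metis max.cobounded2 nat_neq_iff)
qed

lemma card_matchings_containing:
  assumes "finite V" "P \<in> matchings W" "W \<subseteq> V"
  shows "card {Q \<in> matchings V. P \<subseteq> Q} = num_matchings (card V - 2 * card P)"
proof -
  have W: "finite W" using assms finite_subset by blast
  have "card {Q \<in> matchings V. P \<subseteq> Q} = card (matchings (V - W))"
    using bij_betw_same_card[OF bij_betw_matchings_containing[OF assms(2,3)]] by simp
  also have "\<dots> = num_matchings (card V - 2 * card P)"
    using card_matchings[of "V - W"] assms(1,3) W matchings_card[OF W assms(2)]
    by (simp add: card_Diff_subset)
  finally show ?thesis .
qed

text \<open>A matching of a subset extends to a perfect matching whenever the whole set is even.\<close>
lemma matchings_extend:
  assumes "finite V" "even (card V)" "P \<in> matchings W" "W \<subseteq> V"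
  obtains Q where "Q \<in> matchings V" "P \<subseteq> Q"
proof -
  have "card {Q \<in> matchings V. P \<subseteq> Q} > 0"
    using card_matchings_containing[OF assms(1,3,4)] assms(2) by (simp add: num_matchings_pos)
  then show ?thesis using that by (metis (mono_tags, lifting) Collect_empty_eq card.empty less_irrefl)
qed

text \<open>A partial matching leaving at most two vertices uncovered has at most one completion.\<close>
lemma matchings_unique_completion:
  assumes "finite V" "Q \<in> matchings V" "Q' \<in> matchings V" "P \<subseteq> Q" "P \<subseteq> Q'"
    and "card V \<le> 2 * card P + 2"
  shows "Q = Q'"
proof -
  have P: "P \<in> matchings (\<Union>P)" "\<Union>P \<subseteq> V"
    using matchings_subfamily assms matchings_Union by blast+
  have small: "num_matchings i \<le> 1" if "i \<le> 2" for i
  proof -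
    have "i = 0 \<or> i = 1 \<or> i = 2" using that by linarith
    then show ?thesis by (auto simp: numeral_2_eq_2)
  qed
  have "card {Q \<in> matchings V. P \<subseteq> Q} \<le> 1"
    unfolding card_matchings_containing[OF assms(1) P] using assms(6) by (intro small) linarith
  then show ?thesis
    using card_le_Suc0_iff_eq[of "{Q \<in> matchings V. P \<subseteq> Q}"] finite_matchings[OF assms(1)] assms(2-5)
    by auto
qed

section \<open>Components of a union of two matchings\<close>

text \<open>Two involutions \<open>a\<close> and \<open>b\<close> without a common fixed point generate orbits in which a fixed point
  of \<open>b\<close> is accompanied by exactly one other point fixed by \<open>a\<close> or by \<open>b\<close>. If \<open>b\<close> fixes \<open>x\<close>, then the
  orbit of \<open>x\<close> is its cycle under \<open>p = b \<circ> a\<close>. With \<open>N\<close> the length of this cycle, \<open>b\<close> fixes \<open>p\<^sup>i x\<close>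
  iff \<open>N\<close> divides \<open>2 i\<close>, and \<open>a\<close> fixes it iff \<open>N\<close> divides \<open>2 i + 1\<close>; for \<open>0 \<le> i < N\<close> this leaves
  \<open>i = 0\<close> and \<open>i = N div 2\<close>.\<close>
lemma two_ends_of_involutions:
  fixes a b :: "'a \<Rightarrow> 'a"
  assumes a: "\<And>z. a (a z) = z" and b: "\<And>z. b (b z) = z"
    and V: "finite V" "a ` V \<subseteq> V" "b ` V \<subseteq> V" and no_fix: "\<And>z. z \<in> V \<Longrightarrow> a z = z \<Longrightarrow> b z \<noteq> z"
    and x: "x \<in> V" "b x = x"
  defines "R \<equiv> {(u, v). v = a u \<or> v = b u}"
  shows "\<exists>y. y \<noteq> x \<and> {z. (x, z) \<in> R\<^sup>* \<and> (a z = z \<or> b z = z)} = {x, y}"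
proof -
  define p where "p = b \<circ> a"
  have inj_p: "inj p"
    by (rule injI) (metis a b comp_apply p_def)
  then have inj: "(p ^^ i) u = (p ^^ i) v \<longleftrightarrow> u = v" for i u v
    by (metis inj_fn injD)
  \<comment> \<open>Conjugation by \<open>b\<close> inverts \<open>p\<close>.\<close>
  have p_b_p: "p (b (p u)) = b u" for u by (simp add: p_def a b)
  have pbp: "(p ^^ i) (b ((p ^^ i) u)) = b u" for i u
  proof (induction i arbitrary: u)
    case (Suc i)
    have "(p ^^ Suc i) (b ((p ^^ Suc i) u)) = p ((p ^^ i) (b ((p ^^ i) (p u))))"
      by (simp add: funpow_swap1)
    then show ?case by (simp add: Suc p_b_p)
  qed simp
  have pow_b: "(p ^^ i) (b ((p ^^ i) x)) = x" for i using pbp x by simp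
  have a_eq: "a ((p ^^ i) x) = b ((p ^^ Suc i) x)" for i by (simp add: p_def b)
  have pV: "(p ^^ i) x \<in> V" for i
    by (induction i) (use x V in \<open>auto simp: p_def\<close>)
  have "finite {y. \<exists>n. y = (p ^^ n) x}"
    by (rule finite_subset[OF _ V(1)]) (use pV in auto)
  from funpow_inj_finite[OF inj_p this]
  have ex: "\<exists>n. n > 0 \<and> (p ^^ n) x = x" by metis
  define N where "N = (LEAST n. n > 0 \<and> (p ^^ n) x = x)"
  have N: "N > 0" "(p ^^ N) x = x" using LeastI_ex[OF ex] by (simp_all add: N_def)
  have least: "\<not> (0 < n \<and> (p ^^ n) x = x)" if "n < N" for n
    using not_less_Least[of n] that unfolding N_def by blast
  have mult: "(p ^^ (i * N)) x = x" for i
    by (induction i) (use N in \<open>simp_all add: funpow_add\<close>)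
  have period: "(p ^^ i) x = x \<longleftrightarrow> N dvd i" for i
  proof
    assume i: "(p ^^ i) x = x"
    have "(p ^^ i) x = (p ^^ (i mod N)) ((p ^^ (i div N * N)) x)"
      by (metis comp_apply funpow_add mod_div_mult_eq)
    then have "(p ^^ (i mod N)) x = x" using i mult by simp
    then show "N dvd i" using least[of "i mod N"] N by auto
  next
    assume "N dvd i"
    then show "(p ^^ i) x = x" using mult by (auto simp: dvd_def mult.commute)
  qed
  have b_fix: "b ((p ^^ i) x) = (p ^^ i) x \<longleftrightarrow> N dvd 2 * i" for i
  proof -
    have "b ((p ^^ i) x) = (p ^^ i) x \<longleftrightarrow> (p ^^ i) (b ((p ^^ i) x)) = (p ^^ i) ((p ^^ i) x)"
      using inj by simp
    also have "\<dots> \<longleftrightarrow> (p ^^ (i + i)) x = x" using pow_b by (auto simp: funpow_add)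
    finally show ?thesis by (simp add: period mult_2)
  qed
  have a_fix: "a ((p ^^ i) x) = (p ^^ i) x \<longleftrightarrow> N dvd Suc (2 * i)" for i
  proof -
    have "a ((p ^^ i) x) = (p ^^ i) x \<longleftrightarrow>
        (p ^^ Suc i) (b ((p ^^ Suc i) x)) = (p ^^ Suc i) ((p ^^ i) x)"
      using inj[of "Suc i"] a_eq by simp
    also have "\<dots> \<longleftrightarrow> (p ^^ (Suc i + i)) x = x" unfolding funpow_add comp_apply pow_b by (rule eq_commute)
    finally show ?thesis unfolding period by (simp add: mult_2)
  qed
  have b_orbit: "\<exists>j. b ((p ^^ i) x) = (p ^^ j) x" for i
  proof -
    have "i \<le> i * N" using N(1) by (cases N) auto
    then have "(p ^^ i) ((p ^^ (i * N - i)) x) = (p ^^ (i * N)) x"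
      by (metis comp_apply funpow_add le_add_diff_inverse)
    then have "(p ^^ i) ((p ^^ (i * N - i)) x) = (p ^^ i) (b ((p ^^ i) x))" using pow_b mult by simp
    then show ?thesis using inj by metis
  qed
  have a_orbit: "\<exists>j. a ((p ^^ i) x) = (p ^^ j) x" for i
    using b_orbit a_eq by metis
  have orbit: "{z. (x, z) \<in> R\<^sup>*} = {(p ^^ i) x | i. i < N}"
  proof (intro equalityI subsetI)
    fix z assume "z \<in> {z. (x, z) \<in> R\<^sup>*}"
    then have "(x, z) \<in> R\<^sup>*" by simp
    then have "\<exists>i. z = (p ^^ i) x"
    proof (induction rule: rtrancl_induct)
      case base
      show ?case by (rule exI[of _ 0]) simp
    next
      case (step y z)
      then show ?case using a_orbit b_orbit by (auto simp: R_def)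
    qed
    then obtain i where i: "z = (p ^^ i) x" ..
    have "(p ^^ i) x = (p ^^ (i mod N)) ((p ^^ (i div N * N)) x)"
      by (metis comp_apply funpow_add mod_div_mult_eq)
    then have "z = (p ^^ (i mod N)) x" using i mult by simp
    then show "z \<in> {(p ^^ i) x | i. i < N}" using N(1) by force
  next
    fix z assume "z \<in> {(p ^^ i) x | i. i < N}"
    then obtain i where i: "z = (p ^^ i) x" by blast
    have "(x, (p ^^ i) x) \<in> R\<^sup>*"
    proof (induction i)
      case (Suc i)
      have "((p ^^ i) x, a ((p ^^ i) x)) \<in> R" "(a ((p ^^ i) x), (p ^^ Suc i) x) \<in> R"
        by (auto simp: R_def p_def)
      with Suc show ?case by (meson rtrancl.rtrancl_into_rtrancl)
    qed simp
    then show "z \<in> {z. (x, z) \<in> R\<^sup>*}" using i by simp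
  qed
  have dvd_lt: "N dvd c \<longleftrightarrow> c = 0 \<or> c = N" if "c < 2 * N" for c
  proof
    assume "N dvd c"
    then obtain d where "c = N * d" ..
    with that have "d = 0 \<or> d = 1" by (cases d; cases "d - 1") auto
    then show "c = 0 \<or> c = N" using \<open>c = N * d\<close> by auto
  qed auto
  have fix_iff: "a ((p ^^ i) x) = (p ^^ i) x \<or> b ((p ^^ i) x) = (p ^^ i) x \<longleftrightarrow> i = 0 \<or> i = N div 2"
    if "i < N" for i
  proof -
    have *: "N dvd 2 * i \<longleftrightarrow> 2 * i = 0 \<or> 2 * i = N" "N dvd Suc (2 * i) \<longleftrightarrow> Suc (2 * i) = 0 \<or> Suc (2 * i) = N"
      using that by (intro dvd_lt; linarith)+
    then show ?thesis unfolding a_fix b_fix * by presburger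
  qed
  have "N \<noteq> 1"
  proof
    assume "N = 1"
    then have "a x = x" using a_fix[of 0] by simp
    then show False using no_fix x by blast
  qed
  then have half: "0 < N div 2" "N div 2 < N" using N(1) by (auto simp: div_greater_zero_iff)
  have "(p ^^ (N div 2)) x \<noteq> x" using least half by blast
  moreover have "{z. (x, z) \<in> R\<^sup>* \<and> (a z = z \<or> b z = z)} = {x, (p ^^ (N div 2)) x}"
  proof -
    have "{z. (x, z) \<in> R\<^sup>* \<and> (a z = z \<or> b z = z)}
        = {z \<in> {(p ^^ i) x | i. i < N}. a z = z \<or> b z = z}" using orbit by blast
    also have "\<dots> = {(p ^^ i) x | i. i < N \<and> (i = 0 \<or> i = N div 2)}" using fix_iff by blast
    also have "\<dots> = {x, (p ^^ (N div 2)) x}" using N(1) half by force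
    finally show ?thesis .
  qed
  ultimately show ?thesis by blast
qed

text \<open>The involution belonging to a matching: it exchanges the two vertices of each block, and it fixes the
  vertices that the matching does not cover.\<close>
definition mate :: "'a set set \<Rightarrow> 'a \<Rightarrow> 'a" where
  "mate P x = (if x \<in> \<Union>P then THE y. y \<noteq> x \<and> {x, y} \<in> P else x)"

lemma mate_eqI:
  assumes "P \<in> matchings V" "{x, y} \<in> P" "x \<noteq> y"
  shows "mate P x = y"
proof -
  have "(THE y. y \<noteq> x \<and> {x, y} \<in> P) = y"
  proof (rule the_equality)
    fix z assume "z \<noteq> x \<and> {x, z} \<in> P"
    then have "{x, z} = {x, y}" using matchings_disjoint[OF assms(1)] assms(2) by blast
    with \<open>z \<noteq> x \<and> {x, z} \<in> P\<close> show "z = y" by (auto simp: doubleton_eq_iff)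
  qed (use assms in auto)
  then show ?thesis using assms by (auto simp: mate_def)
qed

lemma mate_outside: "P \<in> matchings V \<Longrightarrow> x \<notin> V \<Longrightarrow> mate P x = x"
  by (auto simp: mate_def dest: matchings_Union)

lemma mate_inside:
  assumes "P \<in> matchings V" "x \<in> V"
  shows "mate P x \<noteq> x" "{x, mate P x} \<in> P" "mate P x \<in> V"
proof -
  obtain y where "{x, y} \<in> P" "x \<noteq> y" "y \<in> V" using assms by (rule matchings_pairE)
  moreover from this have "mate P x = y" using mate_eqI assms(1) by metis
  ultimately show "mate P x \<noteq> x" "{x, mate P x} \<in> P" "mate P x \<in> V" by auto
qed

lemma mate_mate:
  assumes "P \<in> matchings V"
  shows "mate P (mate P x) = x"
proof (cases "x \<in> V")
  case True
  then show ?thesis using mate_inside[OF assms True] mate_eqI[OF assms, of "mate P x" x]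
    by (metis insert_commute)
next
  case False
  then show ?thesis using mate_outside[OF assms] by metis
qed

lemma matching_edge_iff_mate:
  assumes "P \<in> matchings V"
  shows "(\<exists>A\<in>P. u \<in> A \<and> v \<in> A) \<longleftrightarrow> u \<in> V \<and> (v = u \<or> v = mate P u)"
proof
  assume "\<exists>A\<in>P. u \<in> A \<and> v \<in> A"
  then obtain A where A: "A \<in> P" "u \<in> A" "v \<in> A" by blast
  then have "u \<in> V" using matchings_Union[OF assms] by blast
  moreover from this have "A = {u, mate P u}"
    using mate_inside[OF assms] matchings_disjoint[OF assms] A by blast
  ultimately show "u \<in> V \<and> (v = u \<or> v = mate P u)" using A by blast
next
  assume "u \<in> V \<and> (v = u \<or> v = mate P u)"
  then show "\<exists>A\<in>P. u \<in> A \<and> v \<in> A" using mate_inside[OF assms] by blast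
qed

text \<open>The graph in which each member of a family of sets is a complete graph with loops.\<close>
definition block_graph :: "'a set set \<Rightarrow> ('a \<times> 'a) set" where
  "block_graph P = (\<Union>A\<in>P. A \<times> A)"

lemma rtrancl_block_graph_matchings:
  assumes "P \<in> matchings V" "Q \<in> matchings W"
  shows "(block_graph (P \<union> Q))\<^sup>* = {(u, v). v = mate P u \<or> v = mate Q u}\<^sup>*" (is "?G\<^sup>* = ?R\<^sup>*")
proof -
  have G: "(u, v) \<in> ?G \<longleftrightarrow> (u \<in> V \<and> (v = u \<or> v = mate P u)) \<or> (u \<in> W \<and> (v = u \<or> v = mate Q u))" for u v
    using matching_edge_iff_mate[OF assms(1), of u v] matching_edge_iff_mate[OF assms(2), of u v]
    unfolding block_graph_def by blast
  have "?G\<^sup>= = ?R\<^sup>="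
    using G mate_outside[OF assms(1)] mate_outside[OF assms(2)] by auto
  then show ?thesis using rtrancl_reflcl[of ?G] rtrancl_reflcl[of ?R] by simp
qed

text \<open>A component of the union of two matchings that contains a vertex covered by only one of them is a
  path, with exactly two such vertices.\<close>
lemma two_ends_of_component:
  assumes "P \<in> matchings V" "Q \<in> matchings W" "finite V" "finite W"
    and x: "x \<in> sym_diff V W"
  shows "\<exists>y. y \<noteq> x \<and> {z \<in> sym_diff V W. (x, z) \<in> (block_graph (P \<union> Q))\<^sup>*} = {x, y}"
proof -
  \<comment> \<open>The situation is symmetric in the two matchings; \<open>x\<close> is a fixed point of \<open>mate Q\<close> here.\<close>
  have main: "\<exists>y. y \<noteq> x \<and> {z \<in> sym_diff V W. (x, z) \<in> (block_graph (P \<union> Q))\<^sup>*} = {x, y}"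
    if P: "P \<in> matchings V" and Q: "Q \<in> matchings W" and fin: "finite V" "finite W"
      and x: "x \<in> V" "x \<notin> W" for P Q :: "'a set set" and V W
  proof -
    let ?R = "{(u, v). v = mate P u \<or> v = mate Q u}"
    have ends: "z \<in> V \<union> W \<Longrightarrow> mate P z = z \<or> mate Q z = z \<longleftrightarrow> z \<in> sym_diff V W" for z
      using mate_outside[OF P] mate_inside[OF P] mate_outside[OF Q] mate_inside[OF Q] by auto
    have maps: "mate P ` (V \<union> W) \<subseteq> V \<union> W" "mate Q ` (V \<union> W) \<subseteq> V \<union> W"
      using mate_outside[OF P] mate_inside[OF P] mate_outside[OF Q] mate_inside[OF Q]
      by (metis Un_iff image_subsetI)+
    have reach: "z \<in> V \<union> W" if "(x, z) \<in> ?R\<^sup>*" for z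
      using that
    proof (induction rule: rtrancl_induct)
      case (step y z)
      then show ?case using maps by auto
    qed (use x in auto)
    have "\<exists>y. y \<noteq> x \<and> {z. (x, z) \<in> ?R\<^sup>* \<and> (mate P z = z \<or> mate Q z = z)} = {x, y}"
    proof (rule two_ends_of_involutions[where V = "V \<union> W"])
      show "mate Q z \<noteq> z" if "z \<in> V \<union> W" "mate P z = z" for z
        using that mate_inside(1)[OF P] mate_inside(1)[OF Q] by blast
    qed (use mate_mate[OF P] mate_mate[OF Q] fin x mate_outside[OF Q] maps in auto)
    also have "{z. (x, z) \<in> ?R\<^sup>* \<and> (mate P z = z \<or> mate Q z = z)}
        = {z \<in> sym_diff V W. (x, z) \<in> ?R\<^sup>*}"
      using reach ends by blast
    finally show ?thesis using rtrancl_block_graph_matchings[OF P Q] by simp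
  qed
  show ?thesis
  proof (cases "x \<in> V")
    case True
    then show ?thesis using main[OF assms(1-4)] x by blast
  next
    case False
    then show ?thesis using main[OF assms(2,1,4,3)] x by (auto simp: Un_commute)
  qed
qed

lemma equiv_reachability:
  assumes "sym R"
  shows "equiv V {(x, y) \<in> V \<times> V. (x, y) \<in> R\<^sup>*}"
proof (rule equivI)
  show "sym {(x, y) \<in> V \<times> V. (x, y) \<in> R\<^sup>*}"
    using symD[OF sym_rtrancl[OF assms]] by (intro symI) auto
  show "trans {(x, y) \<in> V \<times> V. (x, y) \<in> R\<^sup>*}"
    using rtrancl_trans[of _ _ R] by (intro transI) auto
  show "refl_on V {(x, y) \<in> V \<times> V. (x, y) \<in> R\<^sup>*}"
    by (rule refl_onI) auto
qed auto

section \<open>Products of Brauer partitions\<close>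

lemma finite_vertices [simp]: "finite (vertices m n)"
  by (simp add: vertices_def)

lemma card_vertices: "card (vertices m n) = m + n"
proof -
  have "card (Unprimed ` {1..m}) = m" "card (Primed ` {1..n}) = n"
    by (auto simp: card_image inj_on_def)
  then show ?thesis unfolding vertices_def by (subst card_Un_disjoint) auto
qed

lemma product_graph_eq:
  "product_graph \<alpha> \<beta> = block_graph (image lower_to_mid ` \<alpha> \<union> image upper_to_mid ` \<beta>)"
  by (simp add: product_graph_def block_graph_def)

lemma brauer_class:
  assumes "\<alpha> \<in> brauer m n" "\<beta> \<in> brauer n k" "x \<in> vertices m k"
  shows "\<exists>y. y \<noteq> x \<and> {z \<in> vertices m k. (x, z) \<in> (product_graph \<alpha> \<beta>)\<^sup>*} = {x, y}"
proof -
  have inj: "inj_on lower_to_mid (vertices m n)" "inj_on upper_to_mid (vertices n k)"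
    by (auto simp: vertices_def inj_on_def)
  have low: "lower_to_mid ` vertices m n = Unprimed ` {1..m} \<union> Dprimed ` {1..n}"
    and up: "upper_to_mid ` vertices n k = Dprimed ` {1..n} \<union> Primed ` {1..k}"
    by (simp_all add: vertices_def image_Un image_image)
  have "image lower_to_mid ` \<alpha> \<in> matchings (Unprimed ` {1..m} \<union> Dprimed ` {1..n})"
      "image upper_to_mid ` \<beta> \<in> matchings (Dprimed ` {1..n} \<union> Primed ` {1..k})"
    using matchings_image inj assms(1,2) unfolding brauer_eq_matchings low[symmetric] up[symmetric]
    by blast+
  moreover have "sym_diff (Unprimed ` {1..m} \<union> Dprimed ` {1..n}) (Dprimed ` {1..n} \<union> Primed ` {1..k})
      = vertices m k" by (auto simp: vertices_def)
  ultimately show ?thesis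
    using two_ends_of_component[of _ "Unprimed ` {1..m} \<union> Dprimed ` {1..n}" _
        "Dprimed ` {1..n} \<union> Primed ` {1..k}" x] assms(3) unfolding product_graph_eq by simp
qed

lemma equiv_product_graph:
  "equiv V {(x, y) \<in> V \<times> V. (x, y) \<in> (product_graph \<alpha> \<beta>)\<^sup>*}"
  by (rule equiv_reachability) (auto simp: product_graph_def sym_def)

lemma brauer_mult_closed:
  assumes "\<alpha> \<in> brauer m n" "\<beta> \<in> brauer n k"
  shows "brauer_mult m k \<alpha> \<beta> \<in> brauer m k"
proof -
  let ?E = "{(x, y) \<in> vertices m k \<times> vertices m k. (x, y) \<in> (product_graph \<alpha> \<beta>)\<^sup>*}"
  have "card A = 2" if A: "A \<in> vertices m k // ?E" for A
  proof -
    obtain x where x: "x \<in> vertices m k" "A = ?E `` {x}" using A by (auto simp: quotient_def)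
    then have "A = {z \<in> vertices m k. (x, z) \<in> (product_graph \<alpha> \<beta>)\<^sup>*}" by blast
    with brauer_class[OF assms x(1)] show ?thesis by auto
  qed
  then show ?thesis
    unfolding brauer_def brauer_mult_def using partition_on_quotient[OF equiv_product_graph] by blast
qed

text \<open>Blocks of a product have exactly two elements, so a single path between two outer vertices already
  determines a whole block.\<close>
lemma doubleton_in_brauer_mult_iff:
  assumes "\<alpha> \<in> brauer m n" "\<beta> \<in> brauer n k" "x \<in> vertices m k" "y \<in> vertices m k" "x \<noteq> y"
  shows "{x, y} \<in> brauer_mult m k \<alpha> \<beta> \<longleftrightarrow> (x, y) \<in> (product_graph \<alpha> \<beta>)\<^sup>*"
proof -
  let ?E = "{(x, y) \<in> vertices m k \<times> vertices m k. (x, y) \<in> (product_graph \<alpha> \<beta>)\<^sup>*}"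
  show ?thesis
  proof
    assume "{x, y} \<in> brauer_mult m k \<alpha> \<beta>"
    then show "(x, y) \<in> (product_graph \<alpha> \<beta>)\<^sup>*"
      using quotient_eq_iff[OF equiv_product_graph, of "{x, y}" "vertices m k" \<alpha> \<beta> "{x, y}" x y]
      unfolding brauer_mult_def by auto
  next
    assume "(x, y) \<in> (product_graph \<alpha> \<beta>)\<^sup>*"
    moreover obtain w where "{z \<in> vertices m k. (x, z) \<in> (product_graph \<alpha> \<beta>)\<^sup>*} = {x, w}"
      using brauer_class[OF assms(1-3)] by blast
    ultimately have "?E `` {x} = {x, y}" using assms(3-5) by auto
    then show "{x, y} \<in> brauer_mult m k \<alpha> \<beta>"
      using quotientI[OF assms(3), of ?E] unfolding brauer_mult_def by (rule subst)
  qed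
qed

section \<open>Hooks, transversals and rank\<close>

text \<open>The blocks of a Brauer partition that lie within the unprimed (upper) or within the primed (lower)
  vertices; the remaining blocks, which contribute to the rank, are the transversals.\<close>
definition upper_hooks :: "vertex set set \<Rightarrow> vertex set set" where
  "upper_hooks \<alpha> = {A \<in> \<alpha>. A \<subseteq> range Unprimed}"

definition lower_hooks :: "vertex set set \<Rightarrow> vertex set set" where
  "lower_hooks \<alpha> = {A \<in> \<alpha>. A \<subseteq> range Primed}"

lemma brauer_blockE:
  assumes "\<alpha> \<in> brauer m n" "A \<in> \<alpha>"
  obtains x y where "A = {x, y}" "x \<noteq> y" "x \<in> vertices m n" "y \<in> vertices m n"
  using matchings_blockE assms unfolding brauer_eq_matchings by metis

text \<open>Upper hooks of the first factor and lower hooks of the second factor survive in a product.\<close>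
lemma upper_hooks_brauer_mult:
  assumes "\<alpha> \<in> brauer m n" "\<beta> \<in> brauer n k"
  shows "upper_hooks \<alpha> \<subseteq> upper_hooks (brauer_mult m k \<alpha> \<beta>)"
proof
  fix A assume A: "A \<in> upper_hooks \<alpha>"
  then obtain x y where xy: "A = {x, y}" "x \<noteq> y" "x \<in> vertices m n" "y \<in> vertices m n"
    using brauer_blockE[OF assms(1)] unfolding upper_hooks_def by blast
  then have "x \<in> Unprimed ` {1..m}" "y \<in> Unprimed ` {1..m}"
    using A by (auto simp: upper_hooks_def vertices_def)
  then obtain i j where ij: "x = Unprimed i" "y = Unprimed j" "i \<in> {1..m}" "j \<in> {1..m}" by blast
  have "lower_to_mid ` {x, y} = {x, y}" by (simp add: ij)
  then have "(x, y) \<in> product_graph \<alpha> \<beta>"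
    using A xy(1) unfolding product_graph_def upper_hooks_def by blast
  then have "{x, y} \<in> brauer_mult m k \<alpha> \<beta>"
    using doubleton_in_brauer_mult_iff[OF assms, of x y] xy ij by (auto simp: vertices_def)
  with A xy(1) show "A \<in> upper_hooks (brauer_mult m k \<alpha> \<beta>)" by (simp add: upper_hooks_def)
qed

lemma lower_hooks_brauer_mult:
  assumes "\<alpha> \<in> brauer m n" "\<beta> \<in> brauer n k"
  shows "lower_hooks \<beta> \<subseteq> lower_hooks (brauer_mult m k \<alpha> \<beta>)"
proof
  fix A assume A: "A \<in> lower_hooks \<beta>"
  then obtain x y where xy: "A = {x, y}" "x \<noteq> y" "x \<in> vertices n k" "y \<in> vertices n k"
    using brauer_blockE[OF assms(2)] unfolding lower_hooks_def by blast
  then have "x \<in> Primed ` {1..k}" "y \<in> Primed ` {1..k}"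
    using A by (auto simp: lower_hooks_def vertices_def)
  then obtain i j where ij: "x = Primed i" "y = Primed j" "i \<in> {1..k}" "j \<in> {1..k}" by blast
  have "upper_to_mid ` {x, y} = {x, y}" by (simp add: ij)
  then have "(x, y) \<in> product_graph \<alpha> \<beta>"
    using A xy(1) unfolding product_graph_def lower_hooks_def by blast
  then have "{x, y} \<in> brauer_mult m k \<alpha> \<beta>"
    using doubleton_in_brauer_mult_iff[OF assms, of x y] xy ij by (auto simp: vertices_def)
  with A xy(1) show "A \<in> lower_hooks (brauer_mult m k \<alpha> \<beta>)" by (simp add: lower_hooks_def)
qed

lemma brauer_mult_transversal:
  assumes "\<alpha> \<in> brauer m n" "\<beta> \<in> brauer n k"
    and "{Unprimed i, Primed a} \<in> \<alpha>" "{Unprimed a, Primed j} \<in> \<beta>"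
  shows "{Unprimed i, Primed j} \<in> brauer_mult m k \<alpha> \<beta>"
proof -
  have "lower_to_mid ` {Unprimed i, Primed a} = {Unprimed i, Dprimed a}"
    "upper_to_mid ` {Unprimed a, Primed j} = {Dprimed a, Primed j}" by auto
  then have "(Unprimed i, Dprimed a) \<in> product_graph \<alpha> \<beta>" "(Dprimed a, Primed j) \<in> product_graph \<alpha> \<beta>"
    using assms(3,4) unfolding product_graph_def by blast+
  moreover have "Unprimed i \<in> vertices m n" "Primed j \<in> vertices n k"
    using assms matchings_Union unfolding brauer_eq_matchings by blast+
  then have "Unprimed i \<in> vertices m k" "Primed j \<in> vertices m k"
    by (auto simp: vertices_def)
  ultimately show ?thesis
    using doubleton_in_brauer_mult_iff[OF assms(1,2), of "Unprimed i" "Primed j"] by auto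
qed

text \<open>The blocks counted by the rank.\<close>
definition transversals :: "nat \<Rightarrow> nat \<Rightarrow> vertex set set \<Rightarrow> vertex set set" where
  "transversals m n \<alpha> = {A \<in> \<alpha>. A \<inter> Unprimed ` {1..m} \<noteq> {} \<and> A \<inter> Primed ` {1..n} \<noteq> {}}"

lemma brauer_rank_eq: "brauer_rank m n \<alpha> = card (transversals m n \<alpha>)"
  by (simp add: brauer_rank_def transversals_def)

lemma brauer_block_cases:
  assumes "\<alpha> \<in> brauer m n" "A \<in> \<alpha>"
  obtains i j where "A = {Unprimed i, Unprimed j}" "i \<in> {1..m}" "j \<in> {1..m}" "i \<noteq> j"
  | i j where "A = {Unprimed i, Primed j}" "i \<in> {1..m}" "j \<in> {1..n}"
  | i j where "A = {Primed i, Primed j}" "i \<in> {1..n}" "j \<in> {1..n}" "i \<noteq> j"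
proof -
  obtain x y where xy: "A = {x, y}" "x \<noteq> y" "x \<in> vertices m n" "y \<in> vertices m n"
    using brauer_blockE[OF assms] by blast
  then consider i j where "x = Unprimed i" "y = Unprimed j" "i \<in> {1..m}" "j \<in> {1..m}"
    | i j where "x = Unprimed i" "y = Primed j" "i \<in> {1..m}" "j \<in> {1..n}"
    | i j where "x = Primed j" "y = Unprimed i" "i \<in> {1..m}" "j \<in> {1..n}"
    | i j where "x = Primed i" "y = Primed j" "i \<in> {1..n}" "j \<in> {1..n}"
    unfolding vertices_def by blast
  then show ?thesis
  proof cases
    case 3
    with that(2)[of i j] xy(1) show ?thesis by (simp add: insert_commute)
  qed (use that xy(1,2) in auto)
qed

text \<open>The number of unprimed vertices in a block tells its type.\<close>
lemma brauer_block_types: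
  assumes "\<alpha> \<in> brauer m n" "A \<in> \<alpha>"
  defines "u \<equiv> card (A \<inter> Unprimed ` {1..m})" and "l \<equiv> card (A \<inter> Primed ` {1..n})"
  shows "u = (if A \<in> upper_hooks \<alpha> then 2 else 0) + (if A \<in> transversals m n \<alpha> then 1 else 0)"
    and "l = (if A \<in> lower_hooks \<alpha> then 2 else 0) + (if A \<in> transversals m n \<alpha> then 1 else 0)"
    and "A \<in> upper_hooks \<alpha> \<longleftrightarrow> u = 2" and "A \<in> transversals m n \<alpha> \<longleftrightarrow> u = 1"
    and "A \<in> lower_hooks \<alpha> \<longleftrightarrow> u = 0"
proof -
  have "(A \<in> upper_hooks \<alpha> \<and> A \<notin> transversals m n \<alpha> \<and> A \<notin> lower_hooks \<alpha> \<and> u = 2 \<and> l = 0) \<or>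
     (A \<notin> upper_hooks \<alpha> \<and> A \<in> transversals m n \<alpha> \<and> A \<notin> lower_hooks \<alpha> \<and> u = 1 \<and> l = 1) \<or>
     (A \<notin> upper_hooks \<alpha> \<and> A \<notin> transversals m n \<alpha> \<and> A \<in> lower_hooks \<alpha> \<and> u = 0 \<and> l = 2)"
    using assms(1,2)
  proof (cases rule: brauer_block_cases)
    case (1 i j)
    then have "A \<inter> Unprimed ` {1..m} = {Unprimed i, Unprimed j}" "A \<inter> Primed ` {1..n} = {}" by auto
    then show ?thesis
      using 1 assms(2) by (auto simp: u_def l_def upper_hooks_def lower_hooks_def transversals_def)
  next
    case (2 i j)
    then have "A \<inter> Unprimed ` {1..m} = {Unprimed i}" "A \<inter> Primed ` {1..n} = {Primed j}" by auto
    then show ?thesis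
      using 2 assms(2) by (auto simp: u_def l_def upper_hooks_def lower_hooks_def transversals_def)
  next
    case (3 i j)
    then have "A \<inter> Unprimed ` {1..m} = {}" "A \<inter> Primed ` {1..n} = {Primed i, Primed j}" by auto
    then show ?thesis
      using 3 assms(2) by (auto simp: u_def l_def upper_hooks_def lower_hooks_def transversals_def)
  qed
  then show "u = (if A \<in> upper_hooks \<alpha> then 2 else 0) + (if A \<in> transversals m n \<alpha> then 1 else 0)"
    "l = (if A \<in> lower_hooks \<alpha> then 2 else 0) + (if A \<in> transversals m n \<alpha> then 1 else 0)"
    "A \<in> upper_hooks \<alpha> \<longleftrightarrow> u = 2" "A \<in> transversals m n \<alpha> \<longleftrightarrow> u = 1"
    "A \<in> lower_hooks \<alpha> \<longleftrightarrow> u = 0"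
    by auto
qed

text \<open>Since every unprimed and every primed vertex is covered, the rank is determined by the number of
  upper hooks, and also by the number of lower hooks.\<close>
lemma
  assumes "\<alpha> \<in> brauer m n"
  shows card_upper_hooks: "2 * card (upper_hooks \<alpha>) + brauer_rank m n \<alpha> = m"
    and card_lower_hooks: "2 * card (lower_hooks \<alpha>) + brauer_rank m n \<alpha> = n"
proof -
  let ?U = "Unprimed ` {1..m}" and ?L = "Primed ` {1..n}" and ?T = "transversals m n \<alpha>"
  have \<alpha>: "\<alpha> \<in> matchings (vertices m n)" using assms by (simp add: brauer_eq_matchings)
  have fin: "finite \<alpha>" using matchings_finite[OF finite_vertices \<alpha>] .
  have sum_blocks: "(\<Sum>A\<in>\<alpha>. card (A \<inter> S)) = card S" if S: "S \<subseteq> vertices m n" for S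
  proof -
    have "S = (\<Union>A\<in>\<alpha>. A \<inter> S)" using S matchings_Union[OF \<alpha>] by blast
    also have "card \<dots> = (\<Sum>A\<in>\<alpha>. card (A \<inter> S))"
    proof (rule card_UN_disjoint)
      show "\<forall>A\<in>\<alpha>. finite (A \<inter> S)" using S finite_subset[OF _ finite_vertices] by blast
      show "\<forall>A\<in>\<alpha>. \<forall>B\<in>\<alpha>. A \<noteq> B \<longrightarrow> (A \<inter> S) \<inter> (B \<inter> S) = {}"
        using matchings_disjoint[OF \<alpha>] by blast
    qed (rule fin)
    finally show ?thesis by simp
  qed
  have count: "(\<Sum>A\<in>\<alpha>. if A \<in> C then c else 0) = c * card C" if "C \<subseteq> \<alpha>" for C and c :: nat
  proof -
    have "(\<Sum>A\<in>\<alpha>. if A \<in> C then c else 0) = (\<Sum>A\<in>C. c)"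
      using that fin by (intro sum.mono_neutral_cong_right) auto
    then show ?thesis by simp
  qed
  have subs: "upper_hooks \<alpha> \<subseteq> \<alpha>" "lower_hooks \<alpha> \<subseteq> \<alpha>" "?T \<subseteq> \<alpha>"
    by (auto simp: upper_hooks_def lower_hooks_def transversals_def)
  have "(\<Sum>A\<in>\<alpha>. card (A \<inter> ?U))
      = (\<Sum>A\<in>\<alpha>. (if A \<in> upper_hooks \<alpha> then 2 else 0) + (if A \<in> ?T then 1 else 0))"
    by (rule sum.cong[OF refl]) (rule brauer_block_types(1)[OF assms])
  then have "card ?U = 2 * card (upper_hooks \<alpha>) + 1 * card ?T"
    using sum_blocks[of ?U] count[OF subs(1), of 2] count[OF subs(3), of 1]
    by (simp add: sum.distrib vertices_def del: One_nat_def)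
  then show "2 * card (upper_hooks \<alpha>) + brauer_rank m n \<alpha> = m"
    by (simp add: brauer_rank_eq card_image inj_on_def)
  have "(\<Sum>A\<in>\<alpha>. card (A \<inter> ?L))
      = (\<Sum>A\<in>\<alpha>. (if A \<in> lower_hooks \<alpha> then 2 else 0) + (if A \<in> ?T then 1 else 0))"
    by (rule sum.cong[OF refl]) (rule brauer_block_types(2)[OF assms])
  then have "card ?L = 2 * card (lower_hooks \<alpha>) + 1 * card ?T"
    using sum_blocks[of ?L] count[OF subs(2), of 2] count[OF subs(3), of 1]
    by (simp add: sum.distrib vertices_def del: One_nat_def)
  then show "2 * card (lower_hooks \<alpha>) + brauer_rank m n \<alpha> = n"
    by (simp add: brauer_rank_eq card_image inj_on_def)
qed

section \<open>Relabelling, and sandwich elements of equal rank\<close>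

text \<open>Renaming the unprimed vertices by \<open>f\<close> and the primed vertices by \<open>g\<close>;
  doubly primed vertices, which occur in product graphs only, are kept.\<close>
fun relabel :: "(nat \<Rightarrow> nat) \<Rightarrow> (nat \<Rightarrow> nat) \<Rightarrow> vertex \<Rightarrow> vertex" where
  "relabel f g (Unprimed x) = Unprimed (f x)"
| "relabel f g (Primed x) = Primed (g x)"
| "relabel f g (Dprimed x) = Dprimed x"

text \<open>The induced renaming of partitions.\<close>
definition relabel_blocks ::
    "(nat \<Rightarrow> nat) \<Rightarrow> (nat \<Rightarrow> nat) \<Rightarrow> vertex set set \<Rightarrow> vertex set set" where
  "relabel_blocks f g \<alpha> = image (relabel f g) ` \<alpha>"

lemma relabel_vertices:
  assumes "bij_betw f {1..m} {1..m}" "bij_betw g {1..n} {1..n}"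
  shows "relabel f g ` vertices m n = vertices m n" "inj_on (relabel f g) (vertices m n)"
proof -
  have "relabel f g ` vertices m n = Unprimed ` f ` {1..m} \<union> Primed ` g ` {1..n}"
    by (simp add: vertices_def image_Un image_image)
  then show "relabel f g ` vertices m n = vertices m n"
    using assms by (simp add: bij_betw_imp_surj_on vertices_def)
  have "inj_on f {1..m}" "inj_on g {1..n}"
    using assms by (simp_all add: bij_betw_imp_inj_on)
  then show "inj_on (relabel f g) (vertices m n)"
    unfolding vertices_def by (intro inj_onI) (auto simp: inj_on_eq_iff)
qed

lemma relabel_blocks_closed:
  assumes "bij_betw f {1..m} {1..m}" "bij_betw g {1..n} {1..n}" "\<alpha> \<in> brauer m n"
  shows "relabel_blocks f g \<alpha> \<in> brauer m n"
  using matchings_image[of \<alpha> "vertices m n" "relabel f g"] assms relabel_vertices[OF assms(1,2)]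
  by (simp add: brauer_eq_matchings relabel_blocks_def)

lemma finite_brauer: "finite (brauer m n)"
  by (simp add: brauer_eq_matchings finite_matchings)

lemma bij_betw_relabel_blocks:
  assumes "bij_betw f {1..m} {1..m}" "bij_betw g {1..n} {1..n}"
  shows "bij_betw (relabel_blocks f g) (brauer m n) (brauer m n)"
proof -
  have "inj_on (relabel_blocks f g) (Pow (Pow (vertices m n)))"
    unfolding relabel_blocks_def
    by (intro inj_on_image_Pow relabel_vertices(2) assms)
  then have inj: "inj_on (relabel_blocks f g) (brauer m n)"
    by (rule inj_on_subset) (simp add: brauer_eq_matchings matchings_subset_Pow)
  have "relabel_blocks f g ` brauer m n \<subseteq> brauer m n"
    using relabel_blocks_closed[OF assms] by blast
  then show ?thesis using endo_inj_surj[OF finite_brauer _ inj] inj by (simp add: bij_betw_def)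
qed

text \<open>Renaming is compatible with products if the middle vertices are renamed in the same way in both
  factors. As perfect matchings of the same set are equal when one contains the other, it suffices to
  transport paths in one direction.\<close>
lemma relabel_blocks_brauer_mult:
  assumes f: "bij_betw f {1..m} {1..m}" and g: "bij_betw g {1..n} {1..n}"
    and h: "bij_betw h {1..k} {1..k}"
    and \<alpha>: "\<alpha> \<in> brauer m n" and \<beta>: "\<beta> \<in> brauer n k"
  shows "relabel_blocks f h (brauer_mult m k \<alpha> \<beta>)
    = brauer_mult m k (relabel_blocks f g \<alpha>) (relabel_blocks g h \<beta>)"
proof (rule matchings_subset_eq)
  have \<alpha>': "relabel_blocks f g \<alpha> \<in> brauer m n" and \<beta>': "relabel_blocks g h \<beta> \<in> brauer n k"
    using relabel_blocks_closed assms by blast+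
  show "relabel_blocks f h (brauer_mult m k \<alpha> \<beta>) \<in> matchings (vertices m k)"
    using relabel_blocks_closed[OF f h brauer_mult_closed[OF \<alpha> \<beta>]] by (simp add: brauer_eq_matchings)
  show "brauer_mult m k (relabel_blocks f g \<alpha>) (relabel_blocks g h \<beta>) \<in> matchings (vertices m k)"
    using brauer_mult_closed[OF \<alpha>' \<beta>'] by (simp add: brauer_eq_matchings)
  show "relabel_blocks f h (brauer_mult m k \<alpha> \<beta>)
      \<subseteq> brauer_mult m k (relabel_blocks f g \<alpha>) (relabel_blocks g h \<beta>)"
  proof
    \<comment> \<open>The renaming of the vertices of the product graph.\<close>
    define H where "H v = (case v of Unprimed x \<Rightarrow> Unprimed (f x) | Primed x \<Rightarrow> Primed (h x)
        | Dprimed x \<Rightarrow> Dprimed (g x))" for v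
    have H_outer: "v \<in> vertices m k \<Longrightarrow> H v = relabel f h v" for v
      by (auto simp: H_def vertices_def)
    have H_low: "H (lower_to_mid v) = lower_to_mid (relabel f g v)" if "v \<in> vertices m n" for v
      using that by (auto simp: H_def vertices_def)
    have H_up: "H (upper_to_mid v) = upper_to_mid (relabel g h v)" if "v \<in> vertices n k" for v
      using that by (auto simp: H_def vertices_def)
    have edge: "(H u, H v) \<in> product_graph (relabel_blocks f g \<alpha>) (relabel_blocks g h \<beta>)"
      if "(u, v) \<in> product_graph \<alpha> \<beta>" for u v
    proof -
      have sub: "A \<in> \<alpha> \<Longrightarrow> A \<subseteq> vertices m n" "A \<in> \<beta> \<Longrightarrow> A \<subseteq> vertices n k" for A
        using \<alpha> \<beta> matchings_Union unfolding brauer_eq_matchings by blast+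
      from that consider (low) A where "A \<in> \<alpha>" "u \<in> lower_to_mid ` A" "v \<in> lower_to_mid ` A"
        | (up) A where "A \<in> \<beta>" "u \<in> upper_to_mid ` A" "v \<in> upper_to_mid ` A"
        unfolding product_graph_def by blast
      then show ?thesis
      proof cases
        case low
        then obtain u' v' where "u = lower_to_mid u'" "v = lower_to_mid v'" "u' \<in> A" "v' \<in> A" by blast
        moreover from this have "u' \<in> vertices m n" "v' \<in> vertices m n" using sub(1) low(1) by blast+
        ultimately have "H u \<in> lower_to_mid ` relabel f g ` A" "H v \<in> lower_to_mid ` relabel f g ` A"
          using H_low by simp_all
        moreover have "lower_to_mid ` relabel f g ` A \<in> image lower_to_mid ` relabel_blocks f g \<alpha>"
          using low(1) by (simp add: relabel_blocks_def)
        ultimately show ?thesis unfolding product_graph_def by blast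
      next
        case up
        then obtain u' v' where "u = upper_to_mid u'" "v = upper_to_mid v'" "u' \<in> A" "v' \<in> A" by blast
        moreover from this have "u' \<in> vertices n k" "v' \<in> vertices n k" using sub(2) up(1) by blast+
        ultimately have "H u \<in> upper_to_mid ` relabel g h ` A" "H v \<in> upper_to_mid ` relabel g h ` A"
          using H_up by simp_all
        moreover have "upper_to_mid ` relabel g h ` A \<in> image upper_to_mid ` relabel_blocks g h \<beta>"
          using up(1) by (simp add: relabel_blocks_def)
        ultimately show ?thesis unfolding product_graph_def by blast
      qed
    qed
    have path: "(H u, H v) \<in> (product_graph (relabel_blocks f g \<alpha>) (relabel_blocks g h \<beta>))\<^sup>*"
      if "(u, v) \<in> (product_graph \<alpha> \<beta>)\<^sup>*" for u v
      using that
    proof (induction rule: rtrancl_induct)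
      case (step y z)
      show ?case by (rule rtrancl_into_rtrancl[OF step.IH edge[OF step.hyps(2)]])
    qed simp
    fix B assume "B \<in> relabel_blocks f h (brauer_mult m k \<alpha> \<beta>)"
    then obtain A where A: "A \<in> brauer_mult m k \<alpha> \<beta>" "B = relabel f h ` A"
      unfolding relabel_blocks_def by blast
    then obtain x y where xy: "A = {x, y}" "x \<noteq> y" "x \<in> vertices m k" "y \<in> vertices m k"
      using brauer_blockE[OF brauer_mult_closed[OF \<alpha> \<beta>]] by metis
    have "(H x, H y) \<in> (product_graph (relabel_blocks f g \<alpha>) (relabel_blocks g h \<beta>))\<^sup>*"
      using path doubleton_in_brauer_mult_iff[OF \<alpha> \<beta> xy(3,4,2)] A(1) xy(1) by simp
    moreover have "H x = relabel f h x" "H y = relabel f h y" using H_outer xy by simp_all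
    moreover have "relabel f h x \<in> vertices m k" "relabel f h y \<in> vertices m k"
      using relabel_vertices(1)[OF f h] xy by blast+
    moreover have "relabel f h x \<noteq> relabel f h y"
      using relabel_vertices(2)[OF f h] xy by (auto simp: inj_on_def)
    ultimately have "{relabel f h x, relabel f h y}
        \<in> brauer_mult m k (relabel_blocks f g \<alpha>) (relabel_blocks g h \<beta>)"
      using doubleton_in_brauer_mult_iff[OF \<alpha>' \<beta>'] by simp
    then show "B \<in> brauer_mult m k (relabel_blocks f g \<alpha>) (relabel_blocks g h \<beta>)"
      using A(2) xy(1) by simp
  qed
qed

lemma ex_bij_betw_preserving_subset:
  assumes "finite A" "finite B" "card A = card B" "card (A \<inter> C) = card (B \<inter> D)"
  shows "\<exists>F. bij_betw F A B \<and> (\<forall>x\<in>A. F x \<in> D \<longleftrightarrow> x \<in> C)"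
proof -
  obtain F where F: "bij_betw F (A \<inter> C) (B \<inter> D)"
    using finite_same_card_bij assms by (metis finite_Int)
  have "card (A - C) = card (B - D)"
    using assms card_Diff_subset_Int by (metis finite_Int)
  then obtain G where G: "bij_betw G (A - C) (B - D)"
    using finite_same_card_bij assms(1,2) by (metis finite_Diff)
  define K where "K x = (if x \<in> C then F x else G x)" for x
  have "bij_betw K (A \<inter> C) (B \<inter> D)"
    using F by (subst bij_betw_cong[where g = F]) (auto simp: K_def)
  moreover have "bij_betw K (A - C) (B - D)"
    using G by (subst bij_betw_cong[where g = G]) (auto simp: K_def)
  ultimately have "bij_betw K ((A \<inter> C) \<union> (A - C)) ((B \<inter> D) \<union> (B - D))"
    by (rule bij_betw_combine) auto
  moreover have "(A \<inter> C) \<union> (A - C) = A" "(B \<inter> D) \<union> (B - D) = B" by blast+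
  moreover have "K x \<in> D \<longleftrightarrow> x \<in> C" if "x \<in> A" for x
    using that F G by (auto simp: K_def bij_betw_def)
  ultimately show ?thesis by auto
qed

text \<open>Let the vertices in \<open>C\<close>, respectively \<open>D\<close>, be coloured. Two matchings are isomorphic as graphs with
  coloured vertices if, for each \<open>j\<close>, they have equally many blocks with exactly \<open>j\<close> coloured vertices.\<close>
lemma ex_matching_isomorphism:
  assumes "finite P" "P \<in> matchings V" "Q \<in> matchings W" "finite Q"
    and "\<And>j. card {A \<in> P. card (A \<inter> C) = j} = card {A \<in> Q. card (A \<inter> D) = j}"
  shows "\<exists>F. bij_betw F V W \<and> (\<forall>x\<in>V. F x \<in> D \<longleftrightarrow> x \<in> C) \<and> (\<forall>A\<in>P. F ` A \<in> Q)"
  using assms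
proof (induction P arbitrary: V Q W rule: finite_induct)
  case empty
  have "Q = {}"
  proof (rule ccontr)
    assume "Q \<noteq> {}"
    then obtain B where "B \<in> Q" by blast
    then have "card {A \<in> Q. card (A \<inter> D) = card (B \<inter> D)} \<noteq> 0" using empty(3) by auto
    then show False using empty(4)[of "card (B \<inter> D)"] by simp
  qed
  then have "V = {}" "W = {}" using empty matchings_Union by blast+
  then show ?case by (simp add: bij_betw_def)
next
  case (insert A P)
  let ?j = "card (A \<inter> C)"
  have "finite {A' \<in> insert A P. card (A' \<inter> C) = ?j}" "A \<in> {A' \<in> insert A P. card (A' \<inter> C) = ?j}"
    using insert.hyps by auto
  then have "card {A' \<in> insert A P. card (A' \<inter> C) = ?j} \<noteq> 0" by (metis card_0_eq empty_iff)
  then have "{B \<in> Q. card (B \<inter> D) = ?j} \<noteq> {}" using insert.prems(4) by (metis card.empty)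
  then obtain B where B: "B \<in> Q" "card (B \<inter> D) = ?j" by blast
  have A2: "card A = 2" "card B = 2"
    using matchings_card_block insert.prems(1,2) B(1) by blast+
  then have fin: "finite A" "finite B" using card.infinite by fastforce+
  obtain F where F: "bij_betw F A B" "\<forall>x\<in>A. F x \<in> D \<longleftrightarrow> x \<in> C"
    using ex_bij_betw_preserving_subset[OF fin, of C D] A2 B(2) by auto
  have P': "P \<in> matchings (V - A)"
    using matchings_Diff[OF insert.prems(1), of "{A}"] insert.hyps by simp
  have Q': "Q - {B} \<in> matchings (W - B)"
    using matchings_Diff[OF insert.prems(2), of "{B}"] B by simp
  have "card {A \<in> P. card (A \<inter> C) = j} = card {A \<in> Q - {B}. card (A \<inter> D) = j}" for j
  proof -
    have "{A' \<in> P. card (A' \<inter> C) = j} = {A' \<in> insert A P. card (A' \<inter> C) = j} - {A}"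
      using insert.hyps by auto
    moreover have "{A \<in> Q - {B}. card (A \<inter> D) = j} = {A \<in> Q. card (A \<inter> D) = j} - {B}" by auto
    ultimately show ?thesis
      using insert.prems(3,4) insert.hyps B by (simp add: card_Diff_singleton_if)
  qed
  then obtain G where G: "bij_betw G (V - A) (W - B)" "\<forall>x\<in>V - A. G x \<in> D \<longleftrightarrow> x \<in> C"
      "\<forall>A\<in>P. G ` A \<in> Q - {B}"
    using insert.IH[OF P' Q'] insert.prems(3) by auto
  define K where "K x = (if x \<in> A then F x else G x)" for x
  have "bij_betw K A B"
    using F(1) by (subst bij_betw_cong[where g = F]) (auto simp: K_def)
  moreover have "bij_betw K (V - A) (W - B)"
    using G(1) by (subst bij_betw_cong[where g = G]) (auto simp: K_def)
  ultimately have "bij_betw K (A \<union> (V - A)) (B \<union> (W - B))"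
    by (rule bij_betw_combine) auto
  moreover have "A \<union> (V - A) = V" "B \<union> (W - B) = W"
    using matchings_Union insert.prems(1,2) B(1) by blast+
  moreover have "\<forall>x\<in>V. K x \<in> D \<longleftrightarrow> x \<in> C" using F(2) G(2) by (auto simp: K_def)
  moreover have "K ` A' \<in> Q" if "A' \<in> insert A P" for A'
  proof (cases "A' = A")
    case True
    then show ?thesis using F(1) B(1) by (simp add: K_def bij_betw_def)
  next
    case False
    then have "A' \<in> P" "A' \<inter> A = {}"
      using that insert.prems(1) by (auto simp: matchings_iff)
    then have "K ` A' = G ` A'" by (intro image_cong) (auto simp: K_def)
    then show ?thesis using G(3) \<open>A' \<in> P\<close> by auto
  qed
  ultimately show ?case by (intro exI[of _ K]) auto
qed

text \<open>The number that a vertex carries.\<close>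
fun vertex_index :: "vertex \<Rightarrow> nat" where
  "vertex_index (Unprimed x) = x" | "vertex_index (Primed x) = x" | "vertex_index (Dprimed x) = x"

text \<open>The rank determines how many blocks of each type there are, so it is the only invariant of a Brauer
  partition under renaming.\<close>
lemma ex_relabelling_of_same_rank:
  assumes \<sigma>: "\<sigma> \<in> brauer m n" and \<tau>: "\<tau> \<in> brauer m n"
    and rank: "brauer_rank m n \<sigma> = brauer_rank m n \<tau>"
  obtains f g where "bij_betw f {1..m} {1..m}" "bij_betw g {1..n} {1..n}" "relabel_blocks f g \<sigma> = \<tau>"
proof -
  let ?C = "Unprimed ` {1..m}" and ?V = "vertices m n"
  have types: "{A \<in> \<alpha>. card (A \<inter> ?C) = j} = (if j = 2 then upper_hooks \<alpha> else
      if j = 1 then transversals m n \<alpha> else if j = 0 then lower_hooks \<alpha> else {})"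
    if "\<alpha> \<in> brauer m n" for \<alpha> j
  proof -
    have "upper_hooks \<alpha> \<subseteq> \<alpha>" "transversals m n \<alpha> \<subseteq> \<alpha>" "lower_hooks \<alpha> \<subseteq> \<alpha>"
      by (auto simp: upper_hooks_def transversals_def lower_hooks_def)
    moreover have "card (A \<inter> ?C) = j \<longleftrightarrow> (j = 2 \<and> A \<in> upper_hooks \<alpha>) \<or>
        (j = 1 \<and> A \<in> transversals m n \<alpha>) \<or> (j = 0 \<and> A \<in> lower_hooks \<alpha>)" if "A \<in> \<alpha>" for A
    proof -
      define u where "u = card (A \<inter> ?C)"
      note types = brauer_block_types(1,3-5)[OF \<open>\<alpha> \<in> _\<close> that, folded u_def]
      show ?thesis unfolding u_def[symmetric] using types by (auto split: if_splits)
    qed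
    ultimately show ?thesis by (auto simp del: card_0_eq card_eq_0_iff)
  qed
  have "card (upper_hooks \<sigma>) = card (upper_hooks \<tau>)" "card (lower_hooks \<sigma>) = card (lower_hooks \<tau>)"
    using card_upper_hooks[OF \<sigma>] card_upper_hooks[OF \<tau>] card_lower_hooks[OF \<sigma>] card_lower_hooks[OF \<tau>] rank
    by linarith+
  then have "card {A \<in> \<sigma>. card (A \<inter> ?C) = j} = card {A \<in> \<tau>. card (A \<inter> ?C) = j}" for j
    using rank unfolding types[OF \<sigma>] types[OF \<tau>] brauer_rank_eq by simp
  moreover have "finite \<sigma>" "finite \<tau>"
    using \<sigma> \<tau> matchings_finite[OF finite_vertices] unfolding brauer_eq_matchings by blast+
  ultimately obtain F where F: "bij_betw F ?V ?V" "\<forall>x\<in>?V. F x \<in> ?C \<longleftrightarrow> x \<in> ?C" "\<forall>A\<in>\<sigma>. F ` A \<in> \<tau>"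
    using ex_matching_isomorphism[of \<sigma> ?V \<tau> ?V ?C ?C] \<sigma> \<tau>
    unfolding brauer_eq_matchings by blast
  define f where "f i = vertex_index (F (Unprimed i))" for i
  define g where "g i = vertex_index (F (Primed i))" for i
  have Ff: "F (Unprimed i) = Unprimed (f i) \<and> f i \<in> {1..m}" if "i \<in> {1..m}" for i
  proof -
    have "F (Unprimed i) \<in> ?C" using F(2) that by (auto simp: vertices_def)
    then show ?thesis by (auto simp: f_def)
  qed
  have Fg: "F (Primed i) = Primed (g i) \<and> g i \<in> {1..n}" if "i \<in> {1..n}" for i
  proof -
    have i: "Primed i \<in> ?V" "Primed i \<notin> ?C" using that by (auto simp: vertices_def)
    then have "F (Primed i) \<in> ?V - ?C" using F(2) bij_betw_apply[OF F(1) i(1)] by blast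
    then show ?thesis by (auto simp: g_def vertices_def)
  qed
  have inj: "inj_on F ?V" using F(1) by (simp add: bij_betw_def)
  have "inj_on f {1..m}"
  proof (rule inj_onI)
    fix i j assume ij: "i \<in> {1..m}" "j \<in> {1..m}" "f i = f j"
    then have "F (Unprimed i) = F (Unprimed j)" using Ff by simp
    then have "Unprimed i = Unprimed j"
      by (rule inj_onD[OF inj]) (use ij in \<open>auto simp: vertices_def\<close>)
    then show "i = j" by simp
  qed
  moreover have "f ` {1..m} \<subseteq> {1..m}" using Ff by blast
  ultimately have f: "bij_betw f {1..m} {1..m}" by (simp add: bij_betw_def endo_inj_surj)
  have "inj_on g {1..n}"
  proof (rule inj_onI)
    fix i j assume ij: "i \<in> {1..n}" "j \<in> {1..n}" "g i = g j"
    then have "F (Primed i) = F (Primed j)" using Fg by simp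
    then have "Primed i = Primed j"
      by (rule inj_onD[OF inj]) (use ij in \<open>auto simp: vertices_def\<close>)
    then show "i = j" by simp
  qed
  moreover have "g ` {1..n} \<subseteq> {1..n}" using Fg by blast
  ultimately have g: "bij_betw g {1..n} {1..n}" by (simp add: bij_betw_def endo_inj_surj)
  have F_relabel: "F x = relabel f g x" if "x \<in> ?V" for x
    using that Ff Fg by (auto simp: vertices_def)
  have "relabel f g ` A = F ` A" if "A \<in> \<sigma>" for A
  proof (rule image_cong)
    have "A \<subseteq> ?V" using matchings_Union[of \<sigma> ?V] \<sigma> that unfolding brauer_eq_matchings by blast
    then show "relabel f g x = F x" if "x \<in> A" for x using F_relabel that by auto
  qed simp
  then have "relabel_blocks f g \<sigma> \<subseteq> \<tau>" using F(3) by (auto simp: relabel_blocks_def)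
  then have "relabel_blocks f g \<sigma> = \<tau>"
    using matchings_subset_eq[of _ ?V \<tau>] relabel_blocks_closed[OF f g \<sigma>] \<tau>
    unfolding brauer_eq_matchings by simp
  with f g that show ?thesis by blast
qed

text \<open>If renaming carries \<open>\<sigma>\<close> to \<open>\<tau>\<close>, then renaming the elements is an isomorphism of the sandwich
  semigroups.\<close>
lemma sandwich_isomorphic_of_same_rank:
  assumes "\<sigma> \<in> brauer n m" "\<tau> \<in> brauer n m" "brauer_rank n m \<sigma> = brauer_rank n m \<tau>"
  shows "semigroups_isomorphic (brauer m n) (sandwich_mult m n \<sigma>) (brauer m n) (sandwich_mult m n \<tau>)"
proof -
  obtain g f where g: "bij_betw g {1..n} {1..n}" and f: "bij_betw f {1..m} {1..m}"
    and \<tau>: "relabel_blocks g f \<sigma> = \<tau>"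
    using ex_relabelling_of_same_rank[OF assms] .
  have "relabel_blocks f g (sandwich_mult m n \<sigma> \<alpha> \<beta>)
      = sandwich_mult m n \<tau> (relabel_blocks f g \<alpha>) (relabel_blocks f g \<beta>)"
    if "\<alpha> \<in> brauer m n" "\<beta> \<in> brauer m n" for \<alpha> \<beta>
    using relabel_blocks_brauer_mult[OF f f g brauer_mult_closed[OF that(1) assms(1)] that(2)]
      relabel_blocks_brauer_mult[OF f g f that(1) assms(1)] \<tau>
    by (simp add: sandwich_mult_def)
  then show ?thesis
    unfolding semigroups_isomorphic_def using bij_betw_relabel_blocks[OF f g] by blast
qed

section \<open>Sandwich products\<close>

lemma hooks_basics:
  assumes "\<alpha> \<in> brauer m n"
  shows "upper_hooks \<alpha> \<subseteq> \<alpha>" "lower_hooks \<alpha> \<subseteq> \<alpha>" "upper_hooks \<alpha> \<inter> lower_hooks \<alpha> = {}"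
    "finite (upper_hooks \<alpha>)" "finite (lower_hooks \<alpha>)"
proof -
  show sub: "upper_hooks \<alpha> \<subseteq> \<alpha>" "lower_hooks \<alpha> \<subseteq> \<alpha>"
    by (auto simp: upper_hooks_def lower_hooks_def)
  show "upper_hooks \<alpha> \<inter> lower_hooks \<alpha> = {}"
  proof (rule ccontr)
    assume "upper_hooks \<alpha> \<inter> lower_hooks \<alpha> \<noteq> {}"
    then obtain A where A: "A \<in> \<alpha>" "A \<subseteq> range Unprimed" "A \<subseteq> range Primed"
      by (auto simp: upper_hooks_def lower_hooks_def)
    obtain x where "x \<in> A" using brauer_blockE[OF assms A(1)] by blast
    then show False using A by auto
  qed
  have "finite \<alpha>" using assms matchings_finite[OF finite_vertices] unfolding brauer_eq_matchings by blast
  then show "finite (upper_hooks \<alpha>)" "finite (lower_hooks \<alpha>)" using sub finite_subset by blast+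
qed

text \<open>An element is determined by a set of its upper hooks and a set of its lower hooks that together
  leave at most two vertices uncovered. The two sets are given as the hooks of partitions \<open>\<alpha>\<close> and \<open>\<beta>\<close>.\<close>
lemma brauer_completion_unique:
  assumes \<gamma>: "\<gamma> \<in> brauer m n" and \<delta>: "\<delta> \<in> brauer m n"
    and \<alpha>: "\<alpha> \<in> brauer m n'" "upper_hooks \<alpha> \<subseteq> upper_hooks \<gamma>" "upper_hooks \<alpha> \<subseteq> upper_hooks \<delta>"
    and \<beta>: "\<beta> \<in> brauer m' n" "lower_hooks \<beta> \<subseteq> lower_hooks \<gamma>" "lower_hooks \<beta> \<subseteq> lower_hooks \<delta>"
    and rank: "brauer_rank m n' \<alpha> + brauer_rank m' n \<beta> \<le> 2"
  shows "\<gamma> = \<delta>"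
proof (rule matchings_unique_completion)
  let ?P = "upper_hooks \<alpha> \<union> lower_hooks \<beta>"
  show "?P \<subseteq> \<gamma>" "?P \<subseteq> \<delta>"
    using \<alpha>(2,3) \<beta>(2,3) hooks_basics(1,2)[OF \<gamma>] hooks_basics(1,2)[OF \<delta>] by auto
  have "upper_hooks \<alpha> \<inter> lower_hooks \<beta> = {}" using \<alpha>(2) \<beta>(2) hooks_basics(3)[OF \<gamma>] by blast
  then have "card ?P = card (upper_hooks \<alpha>) + card (lower_hooks \<beta>)"
    using hooks_basics(4)[OF \<alpha>(1)] hooks_basics(5)[OF \<beta>(1)] by (simp add: card_Un_disjoint)
  then show "card (vertices m n) \<le> 2 * card ?P + 2"
    using card_upper_hooks[OF \<alpha>(1)] card_lower_hooks[OF \<beta>(1)] rank card_vertices[of m n] by linarith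
qed (use \<gamma> \<delta> in \<open>simp_all add: brauer_eq_matchings\<close>)

text \<open>More hooks on one side mean a smaller rank, also between partitions that agree on one index only.\<close>
lemma brauer_rank_antimono_upper:
  assumes "\<alpha> \<in> brauer m n" "\<gamma> \<in> brauer m k" "upper_hooks \<alpha> \<subseteq> upper_hooks \<gamma>"
  shows "brauer_rank m k \<gamma> \<le> brauer_rank m n \<alpha>"
  using card_upper_hooks[OF assms(1)] card_upper_hooks[OF assms(2)]
    card_mono[OF hooks_basics(4)[OF assms(2)] assms(3)] by linarith

lemma brauer_rank_antimono_lower:
  assumes "\<beta> \<in> brauer n k" "\<gamma> \<in> brauer m k" "lower_hooks \<beta> \<subseteq> lower_hooks \<gamma>"
  shows "brauer_rank m k \<gamma> \<le> brauer_rank n k \<beta>"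
  using card_lower_hooks[OF assms(1)] card_lower_hooks[OF assms(2)]
    card_mono[OF hooks_basics(5)[OF assms(2)] assms(3)] by linarith

lemma brauer_rank_bounds:
  assumes "\<alpha> \<in> brauer m n"
  shows "brauer_rank m n \<alpha> \<le> m" "brauer_rank m n \<alpha> \<le> n"
    "brauer_rank m n \<alpha> mod 2 = m mod 2" "brauer_rank m n \<alpha> mod 2 = n mod 2"
  using card_upper_hooks[OF assms] card_lower_hooks[OF assms] by presburger+

lemma card_brauer: "card (brauer m n) = num_matchings (m + n)"
  using card_matchings[OF finite_vertices, of m n] by (simp add: brauer_eq_matchings card_vertices)

lemma
  assumes "\<sigma> \<in> brauer n m" "\<alpha> \<in> brauer m n" "\<beta> \<in> brauer m n"
  shows sandwich_mult_closed: "sandwich_mult m n \<sigma> \<alpha> \<beta> \<in> brauer m n"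
    and upper_hooks_sandwich: "upper_hooks \<alpha> \<subseteq> upper_hooks (sandwich_mult m n \<sigma> \<alpha> \<beta>)"
    and lower_hooks_sandwich: "lower_hooks \<beta> \<subseteq> lower_hooks (sandwich_mult m n \<sigma> \<alpha> \<beta>)"
    and brauer_rank_sandwich: "brauer_rank m n (sandwich_mult m n \<sigma> \<alpha> \<beta>) \<le> brauer_rank n m \<sigma>"
proof -
  have \<alpha>\<sigma>: "brauer_mult m m \<alpha> \<sigma> \<in> brauer m m" using brauer_mult_closed assms by blast
  show closed: "sandwich_mult m n \<sigma> \<alpha> \<beta> \<in> brauer m n"
    unfolding sandwich_mult_def using brauer_mult_closed[OF \<alpha>\<sigma> assms(3)] .
  have up: "upper_hooks (brauer_mult m m \<alpha> \<sigma>) \<subseteq> upper_hooks (sandwich_mult m n \<sigma> \<alpha> \<beta>)"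
    unfolding sandwich_mult_def using upper_hooks_brauer_mult[OF \<alpha>\<sigma> assms(3)] .
  with upper_hooks_brauer_mult[OF assms(2,1)]
  show "upper_hooks \<alpha> \<subseteq> upper_hooks (sandwich_mult m n \<sigma> \<alpha> \<beta>)" by blast
  show "lower_hooks \<beta> \<subseteq> lower_hooks (sandwich_mult m n \<sigma> \<alpha> \<beta>)"
    unfolding sandwich_mult_def using lower_hooks_brauer_mult[OF \<alpha>\<sigma> assms(3)] .
  have "brauer_rank m n (sandwich_mult m n \<sigma> \<alpha> \<beta>) \<le> brauer_rank m m (brauer_mult m m \<alpha> \<sigma>)"
    by (rule brauer_rank_antimono_upper[OF \<alpha>\<sigma> closed up])
  also have "\<dots> \<le> brauer_rank n m \<sigma>"
    by (rule brauer_rank_antimono_lower[OF assms(1) \<alpha>\<sigma> lower_hooks_brauer_mult[OF assms(2,1)]])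
  finally show "brauer_rank m n (sandwich_mult m n \<sigma> \<alpha> \<beta>) \<le> brauer_rank n m \<sigma>" .
qed

lemma brauer_rank_sandwich_le:
  assumes "\<sigma> \<in> brauer n m" "\<alpha> \<in> brauer m n" "\<beta> \<in> brauer m n"
  shows "brauer_rank m n (sandwich_mult m n \<sigma> \<alpha> \<beta>) \<le> brauer_rank m n \<alpha>"
    and "brauer_rank m n (sandwich_mult m n \<sigma> \<alpha> \<beta>) \<le> brauer_rank m n \<beta>"
  using brauer_rank_antimono_upper[OF assms(2) _ upper_hooks_sandwich[OF assms]]
    brauer_rank_antimono_lower[OF assms(3) _ lower_hooks_sandwich[OF assms]]
    sandwich_mult_closed[OF assms] by blast+

section \<open>The set of all products\<close>

text \<open>The transversals, given by the numbers of their two vertices.\<close>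
definition transversal_pairs :: "vertex set set \<Rightarrow> (nat \<times> nat) set" where
  "transversal_pairs \<alpha> = {(i, j). {Unprimed i, Primed j} \<in> \<alpha>}"

lemma transversal_pairs_unique:
  assumes "\<alpha> \<in> brauer m n" "(i, j) \<in> transversal_pairs \<alpha>" "(i', j') \<in> transversal_pairs \<alpha>"
  shows "i = i' \<longleftrightarrow> j = j'"
proof -
  have eq: "A = B" if "A \<in> \<alpha>" "B \<in> \<alpha>" "x \<in> A" "x \<in> B" for A B x
    using matchings_disjoint that assms(1) unfolding brauer_eq_matchings by metis
  have "{Unprimed i, Primed j} \<in> \<alpha>" "{Unprimed i', Primed j'} \<in> \<alpha>"
    using assms(2,3) by (auto simp: transversal_pairs_def)
  from eq[OF this, of "Unprimed i"] eq[OF this, of "Primed j"] show ?thesis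
    by (auto simp: doubleton_eq_iff)
qed

lemma transversals_eq_image:
  assumes "\<alpha> \<in> brauer m n"
  shows "transversals m n \<alpha> = (\<lambda>(i, j). {Unprimed i, Primed j}) ` transversal_pairs \<alpha>"
proof (intro equalityI subsetI)
  fix A assume A: "A \<in> transversals m n \<alpha>"
  then have "A \<in> \<alpha>" by (simp add: transversals_def)
  with assms show "A \<in> (\<lambda>(i, j). {Unprimed i, Primed j}) ` transversal_pairs \<alpha>"
    by (cases rule: brauer_block_cases)
      (use A \<open>A \<in> \<alpha>\<close> in \<open>auto simp: transversals_def transversal_pairs_def\<close>)
next
  fix A assume "A \<in> (\<lambda>(i, j). {Unprimed i, Primed j}) ` transversal_pairs \<alpha>"
  then obtain i j where A: "A = {Unprimed i, Primed j}" "A \<in> \<alpha>"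
    by (auto simp: transversal_pairs_def)
  then have "Unprimed i \<in> vertices m n" "Primed j \<in> vertices m n"
    using assms matchings_Union unfolding brauer_eq_matchings by blast+
  then show "A \<in> transversals m n \<alpha>" using A by (auto simp: vertices_def transversals_def)
qed

lemma
  assumes "\<alpha> \<in> brauer m n"
  shows finite_transversal_pairs: "finite (transversal_pairs \<alpha>)"
    and card_transversal_pairs: "card (transversal_pairs \<alpha>) = brauer_rank m n \<alpha>"
proof -
  have inj: "inj_on (\<lambda>(i, j). {Unprimed i, Primed j}) (transversal_pairs \<alpha>)"
    by (rule inj_onI) (auto simp: doubleton_eq_iff)
  have "finite \<alpha>"
    using assms matchings_finite[OF finite_vertices] unfolding brauer_eq_matchings by blast
  then have "finite (transversals m n \<alpha>)" by (simp add: transversals_def)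
  then show "finite (transversal_pairs \<alpha>)"
    using inj transversals_eq_image[OF assms] finite_imageD by metis
  show "card (transversal_pairs \<alpha>) = brauer_rank m n \<alpha>"
    unfolding brauer_rank_eq transversals_eq_image[OF assms] card_image[OF inj] ..
qed

lemma brauer_block_hook_or_transversal:
  assumes "\<alpha> \<in> brauer m n" "A \<in> \<alpha>"
  obtains "A \<in> upper_hooks \<alpha>" | "A \<in> lower_hooks \<alpha>"
  | i j where "A = {Unprimed i, Primed j}" "(i, j) \<in> transversal_pairs \<alpha>"
  using assms
  by (cases rule: brauer_block_cases)
    (use assms(2) that in \<open>auto simp: upper_hooks_def lower_hooks_def transversal_pairs_def\<close>)

lemma brauer_extend:
  assumes "even (m + n)" "P \<in> matchings W" "W \<subseteq> vertices m n"
  obtains \<alpha> where "\<alpha> \<in> brauer m n" "P \<subseteq> \<alpha>"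
  using matchings_extend[OF finite_vertices _ assms(2,3)] assms(1)
  by (auto simp: card_vertices brauer_eq_matchings)

text \<open>Conversely to the bound \<open>brauer_rank_sandwich\<close>, every \<open>\<gamma>\<close> whose rank is at most that of \<open>\<sigma>\<close> is a
  product. Map each transversal \<open>{i, j'}\<close> of \<open>\<gamma>\<close> injectively to a transversal \<open>{a, b'}\<close> of \<open>\<sigma>\<close>. Let
  \<open>\<alpha>\<close> contain the upper hooks of \<open>\<gamma>\<close> and the blocks \<open>{i, a'}\<close>, and let \<open>\<beta>\<close> contain the lower hooks
  of \<open>\<gamma>\<close> and the blocks \<open>{b, j'}\<close>; the other blocks of \<open>\<alpha>\<close> and \<open>\<beta>\<close> do not matter. Then each block
  of \<open>\<gamma>\<close> is a block of \<open>\<alpha>\<sigma>\<beta>\<close>.\<close>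
lemma sandwich_product_of_rank_le:
  assumes \<sigma>: "\<sigma> \<in> brauer n m" and \<gamma>: "\<gamma> \<in> brauer m n"
    and rank: "brauer_rank m n \<gamma> \<le> brauer_rank n m \<sigma>"
  obtains \<alpha> \<beta> where "\<alpha> \<in> brauer m n" "\<beta> \<in> brauer m n" "sandwich_mult m n \<sigma> \<alpha> \<beta> = \<gamma>"
proof -
  let ?T = "transversal_pairs \<gamma>" and ?S = "transversal_pairs \<sigma>"
  obtain h where h: "h ` ?T \<subseteq> ?S" "inj_on h ?T"
    using card_le_inj[OF finite_transversal_pairs[OF \<gamma>] finite_transversal_pairs[OF \<sigma>]] rank
    by (auto simp: card_transversal_pairs[OF \<gamma>] card_transversal_pairs[OF \<sigma>])
  \<comment> \<open>\<open>a j\<close> and \<open>b i\<close> are the two ends of the transversal of \<open>\<sigma>\<close> assigned to \<open>{i, j'}\<close>; the block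
      is determined by \<open>j\<close> alone and by \<open>i\<close> alone.\<close>
  define a where "a j = fst (h (THE p. p \<in> ?T \<and> snd p = j))" for j
  define b where "b i = snd (h (THE p. p \<in> ?T \<and> fst p = i))" for i
  have a: "a j = fst (h (i, j))" and b: "b i = snd (h (i, j))" if "(i, j) \<in> ?T" for i j
  proof -
    have "(THE p. p \<in> ?T \<and> snd p = j) = (i, j)"
    proof (rule the_equality)
      show "p = (i, j)" if "p \<in> ?T \<and> snd p = j" for p
        using that transversal_pairs_unique[OF \<gamma> \<open>(i, j) \<in> ?T\<close>, of "fst p" "snd p"] by (cases p) simp
    qed (use that in simp)
    then show "a j = fst (h (i, j))" by (simp add: a_def)
    have "(THE p. p \<in> ?T \<and> fst p = i) = (i, j)"
    proof (rule the_equality)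
      show "p = (i, j)" if "p \<in> ?T \<and> fst p = i" for p
        using that transversal_pairs_unique[OF \<gamma> \<open>(i, j) \<in> ?T\<close>, of "fst p" "snd p"] by (cases p) simp
    qed (use that in simp)
    then show "b i = snd (h (i, j))" by (simp add: b_def)
  qed
  have ab: "(a j, b i) \<in> ?S" if "(i, j) \<in> ?T" for i j
    using h(1) that a[OF that] b[OF that] by auto
  have ab_inj: "i = i' \<and> j = j'"
    if "(i, j) \<in> ?T" "(i', j') \<in> ?T" "a j = a j' \<or> b i = b i'" for i j i' j'
  proof -
    have "a j = a j' \<longleftrightarrow> b i = b i'"
      by (rule transversal_pairs_unique[OF \<sigma> ab[OF that(1)] ab[OF that(2)]])
    then have "h (i, j) = h (i', j')"
      using that a b by (metis prod_eqI)
    then show ?thesis using h(2) that by (auto dest: inj_onD)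
  qed
  have S_bounds: "i \<in> {1..n}" "j \<in> {1..m}" if "(i, j) \<in> ?S" for i j
  proof -
    have "Unprimed i \<in> vertices n m" "Primed j \<in> vertices n m"
      using that \<sigma> matchings_Union unfolding brauer_eq_matchings transversal_pairs_def by blast+
    then show "i \<in> {1..n}" "j \<in> {1..m}" by (auto simp: vertices_def)
  qed
  have even: "even (m + n)" using brauer_rank_bounds(3,4)[OF \<gamma>] by presburger
  have \<gamma>': "\<gamma> \<in> matchings (vertices m n)" using \<gamma> by (simp add: brauer_eq_matchings)
  have T_\<gamma>: "{{Unprimed i, Primed j} | i j. (i, j) \<in> ?T} \<subseteq> \<gamma>" by (auto simp: transversal_pairs_def)
  define Pa where "Pa = upper_hooks \<gamma> \<union> {{Unprimed i, Primed j} | i j. (i, j) \<in> ?T}"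
  define Pb where "Pb = lower_hooks \<gamma> \<union> {{Unprimed i, Primed j} | i j. (i, j) \<in> ?T}"
  have P_sub: "Pa \<subseteq> \<gamma>" "Pb \<subseteq> \<gamma>"
    using hooks_basics(1,2)[OF \<gamma>] T_\<gamma> by (auto simp: Pa_def Pb_def)
  have Pa_cases: "x \<in> Unprimed ` {1..m} \<or> (\<exists>i j. x = Primed j \<and> (i, j) \<in> ?T)" if "x \<in> \<Union>Pa" for x
  proof -
    have "x \<in> vertices m n" using that P_sub(1) matchings_Union[OF \<gamma>'] by blast
    then show ?thesis using that by (auto simp: Pa_def upper_hooks_def vertices_def)
  qed
  have Pb_cases: "x \<in> Primed ` {1..n} \<or> (\<exists>i j. x = Unprimed i \<and> (i, j) \<in> ?T)" if "x \<in> \<Union>Pb" for x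
  proof -
    have "x \<in> vertices m n" using that P_sub(2) matchings_Union[OF \<gamma>'] by blast
    then show ?thesis using that by (auto simp: Pb_def lower_hooks_def vertices_def)
  qed
  \<comment> \<open>The prescribed parts of \<open>\<alpha>\<close> and \<open>\<beta>\<close> are injective renamings of parts of \<open>\<gamma>\<close>, and so they are
      matchings, which can be extended.\<close>
  have "inj_on (relabel id a) (\<Union>Pa)"
  proof (rule inj_onI)
    fix x y assume "x \<in> \<Union>Pa" "y \<in> \<Union>Pa" "relabel id a x = relabel id a y"
    with Pa_cases[of x] Pa_cases[of y] show "x = y" using ab_inj by fastforce
  qed
  then have "image (relabel id a) ` Pa \<in> matchings (relabel id a ` \<Union>Pa)"
    using matchings_image matchings_subfamily[OF \<gamma>' P_sub(1)] by blast
  moreover have "relabel id a ` \<Union>Pa \<subseteq> vertices m n"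
  proof
    fix y assume "y \<in> relabel id a ` \<Union>Pa"
    then obtain x where x: "x \<in> \<Union>Pa" "y = relabel id a x" by blast
    from Pa_cases[OF x(1)] x(2) show "y \<in> vertices m n"
      using S_bounds(1)[OF ab] by (auto simp: vertices_def)
  qed
  ultimately obtain \<alpha> where \<alpha>: "\<alpha> \<in> brauer m n" "image (relabel id a) ` Pa \<subseteq> \<alpha>"
    using brauer_extend[OF even] by metis
  have "inj_on (relabel b id) (\<Union>Pb)"
  proof (rule inj_onI)
    fix x y assume "x \<in> \<Union>Pb" "y \<in> \<Union>Pb" "relabel b id x = relabel b id y"
    with Pb_cases[of x] Pb_cases[of y] show "x = y" using ab_inj by fastforce
  qed
  then have "image (relabel b id) ` Pb \<in> matchings (relabel b id ` \<Union>Pb)"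
    using matchings_image matchings_subfamily[OF \<gamma>' P_sub(2)] by blast
  moreover have "relabel b id ` \<Union>Pb \<subseteq> vertices m n"
  proof
    fix y assume "y \<in> relabel b id ` \<Union>Pb"
    then obtain x where x: "x \<in> \<Union>Pb" "y = relabel b id x" by blast
    from Pb_cases[OF x(1)] x(2) show "y \<in> vertices m n"
      using S_bounds(2)[OF ab] by (auto simp: vertices_def)
  qed
  ultimately obtain \<beta> where \<beta>: "\<beta> \<in> brauer m n" "image (relabel b id) ` Pb \<subseteq> \<beta>"
    using brauer_extend[OF even] by metis
  have \<alpha>\<sigma>: "brauer_mult m m \<alpha> \<sigma> \<in> brauer m m" using brauer_mult_closed[OF \<alpha>(1) \<sigma>] .
  have "\<gamma> \<subseteq> sandwich_mult m n \<sigma> \<alpha> \<beta>"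
  proof
    fix A assume "A \<in> \<gamma>"
    with \<gamma> show "A \<in> sandwich_mult m n \<sigma> \<alpha> \<beta>"
    proof (cases rule: brauer_block_hook_or_transversal)
      case 1
      have "relabel id a x = x" if "x \<in> A" for x using 1 that by (auto simp: upper_hooks_def)
      then have "relabel id a ` A = A" by simp
      moreover have "A \<in> Pa" using 1 by (simp add: Pa_def)
      ultimately have "A \<in> \<alpha>" using \<alpha>(2) by (metis image_eqI subsetD)
      then have "A \<in> upper_hooks \<alpha>" using 1 by (simp add: upper_hooks_def)
      then show ?thesis
        using upper_hooks_sandwich[OF \<sigma> \<alpha>(1) \<beta>(1)] by (auto simp: upper_hooks_def)
    next
      case 2
      have "relabel b id x = x" if "x \<in> A" for x using 2 that by (auto simp: lower_hooks_def)
      then have "relabel b id ` A = A" by simp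
      moreover have "A \<in> Pb" using 2 by (simp add: Pb_def)
      ultimately have "A \<in> \<beta>" using \<beta>(2) by (metis image_eqI subsetD)
      then have "A \<in> lower_hooks \<beta>" using 2 by (simp add: lower_hooks_def)
      then show ?thesis
        using lower_hooks_sandwich[OF \<sigma> \<alpha>(1) \<beta>(1)] by (auto simp: lower_hooks_def)
    next
      case (3 i j)
      have "A \<in> Pa" "A \<in> Pb" using 3 by (auto simp: Pa_def Pb_def)
      then have "relabel id a ` A \<in> \<alpha>" "relabel b id ` A \<in> \<beta>" using \<alpha>(2) \<beta>(2) by blast+
      then have "{Unprimed i, Primed (a j)} \<in> \<alpha>" "{Unprimed (b i), Primed j} \<in> \<beta>"
        by (simp_all add: 3(1))
      moreover have "{Unprimed (a j), Primed (b i)} \<in> \<sigma>"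
        using ab[OF 3(2)] by (simp add: transversal_pairs_def)
      ultimately have "{Unprimed i, Primed j} \<in> sandwich_mult m n \<sigma> \<alpha> \<beta>"
        unfolding sandwich_mult_def
        using brauer_mult_transversal[OF \<alpha>\<sigma> \<beta>(1)] brauer_mult_transversal[OF \<alpha>(1) \<sigma>] by blast
      then show ?thesis by (simp add: 3(1))
    qed
  qed
  then have "\<gamma> = sandwich_mult m n \<sigma> \<alpha> \<beta>"
    using matchings_subset_eq[OF \<gamma>'] sandwich_mult_closed[OF \<sigma> \<alpha>(1) \<beta>(1)]
    by (simp add: brauer_eq_matchings)
  with \<alpha>(1) \<beta>(1) that show ?thesis by blast
qed

lemma sandwich_products:
  assumes "\<sigma> \<in> brauer n m"
  shows "(\<lambda>(\<alpha>, \<beta>). sandwich_mult m n \<sigma> \<alpha> \<beta>) ` (brauer m n \<times> brauer m n)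
    = {\<gamma> \<in> brauer m n. brauer_rank m n \<gamma> \<le> brauer_rank n m \<sigma>}"
proof (intro equalityI subsetI)
  fix \<gamma> assume "\<gamma> \<in> (\<lambda>(\<alpha>, \<beta>). sandwich_mult m n \<sigma> \<alpha> \<beta>) ` (brauer m n \<times> brauer m n)"
  then show "\<gamma> \<in> {\<gamma> \<in> brauer m n. brauer_rank m n \<gamma> \<le> brauer_rank n m \<sigma>}"
    using sandwich_mult_closed[OF assms] brauer_rank_sandwich[OF assms] by auto
next
  fix \<gamma> assume "\<gamma> \<in> {\<gamma> \<in> brauer m n. brauer_rank m n \<gamma> \<le> brauer_rank n m \<sigma>}"
  then obtain \<alpha> \<beta> where "\<alpha> \<in> brauer m n" "\<beta> \<in> brauer m n" "sandwich_mult m n \<sigma> \<alpha> \<beta> = \<gamma>"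
    using sandwich_product_of_rank_le[OF assms] by blast
  then show "\<gamma> \<in> (\<lambda>(\<alpha>, \<beta>). sandwich_mult m n \<sigma> \<alpha> \<beta>) ` (brauer m n \<times> brauer m n)" by force
qed

text \<open>Exchanging unprimed and primed vertices; it turns \<open>\<sigma>\<close> into an element of the sandwich semigroup.\<close>
fun flip :: "vertex \<Rightarrow> vertex" where
  "flip (Unprimed x) = Primed x" | "flip (Primed x) = Unprimed x" | "flip (Dprimed x) = Dprimed x"

lemma ex_brauer_of_rank:
  assumes "\<sigma> \<in> brauer n m"
  obtains \<gamma> where "\<gamma> \<in> brauer m n" "brauer_rank m n \<gamma> = brauer_rank n m \<sigma>"
proof -
  let ?\<gamma> = "image flip ` \<sigma>"
  have inv: "flip (flip x) = x" for x by (cases x) auto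
  then have inj: "inj flip" by (rule inj_on_inverseI)
  have "flip ` vertices n m = vertices m n"
    by (simp add: vertices_def image_Un image_image Un_commute)
  then have \<gamma>: "?\<gamma> \<in> brauer m n"
    using matchings_image[of \<sigma> "vertices n m" flip] assms inj_on_subset[OF inj]
    by (simp add: brauer_eq_matchings)
  have "flip ` A \<subseteq> range Unprimed \<longleftrightarrow> A \<subseteq> range Primed" for A
  proof -
    have "flip x \<in> range Unprimed \<longleftrightarrow> x \<in> range Primed" for x by (cases x) auto
    then show ?thesis by blast
  qed
  then have "upper_hooks ?\<gamma> = image flip ` lower_hooks \<sigma>"
    by (auto simp: upper_hooks_def lower_hooks_def)
  then have "card (upper_hooks ?\<gamma>) = card (lower_hooks \<sigma>)"
    using inj by (metis card_image inj_on_image inj_on_subset subset_UNIV inj_image_eq_iff inj_onI)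
  then have "brauer_rank m n ?\<gamma> = brauer_rank n m \<sigma>"
    using card_upper_hooks[OF \<gamma>] card_lower_hooks[OF assms] by linarith
  with \<gamma> that show ?thesis by blast
qed

section \<open>Elements of rank at most one\<close>

text \<open>An element whose upper hooks cover all unprimed vertices, except for the vertex \<open>1\<close> if \<open>m\<close> is odd.\<close>
lemma ex_brauer_of_rank_le_1:
  assumes "m mod 2 = n mod 2"
  obtains \<alpha> where "\<alpha> \<in> brauer m n" "brauer_rank m n \<alpha> \<le> 1"
proof -
  let ?U = "Unprimed ` {Suc (m mod 2)..m}"
  have cU: "card ?U = m - m mod 2" by (simp add: card_image inj_on_def)
  have "even (card ?U)" unfolding cU by (simp add: minus_mod_eq_mult_div)
  moreover have "{} \<in> matchings {}" by (simp add: matchings_iff)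
  ultimately obtain P where P: "P \<in> matchings ?U"
    using matchings_extend[of ?U "{}" "{}"] by blast
  have "even (m + n)" using assms by presburger
  moreover have sub: "?U \<subseteq> vertices m n" by (auto simp: vertices_def)
  ultimately obtain \<alpha> where \<alpha>: "\<alpha> \<in> brauer m n" "P \<subseteq> \<alpha>" using brauer_extend[OF _ P] by metis
  have "A \<subseteq> range Unprimed" if "A \<in> P" for A using that matchings_Union[OF P] by blast
  then have "P \<subseteq> upper_hooks \<alpha>" using \<alpha>(2) by (auto simp: upper_hooks_def)
  then have "card P \<le> card (upper_hooks \<alpha>)" using card_mono hooks_basics(4)[OF \<alpha>(1)] by blast
  moreover have "2 * card P = m - m mod 2" using matchings_card[OF _ P] cU by simp
  ultimately have "brauer_rank m n \<alpha> \<le> 1" using card_upper_hooks[OF \<alpha>(1)] by linarith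
  with \<alpha>(1) that show ?thesis by blast
qed

text \<open>The elements of rank at most one are characterised by the multiplication alone; they form the
  minimal ideal, which is a rectangular band.\<close>
lemma sandwich_low_rank_iff:
  assumes \<sigma>: "\<sigma> \<in> brauer n m" and \<alpha>: "\<alpha> \<in> brauer m n"
  shows "brauer_rank m n \<alpha> \<le> 1 \<longleftrightarrow>
    (\<forall>\<beta>\<in>brauer m n. sandwich_mult m n \<sigma> (sandwich_mult m n \<sigma> \<alpha> \<beta>) \<alpha> = \<alpha>)"
proof
  assume rank: "brauer_rank m n \<alpha> \<le> 1"
  show "\<forall>\<beta>\<in>brauer m n. sandwich_mult m n \<sigma> (sandwich_mult m n \<sigma> \<alpha> \<beta>) \<alpha> = \<alpha>"
  proof
    fix \<beta> assume \<beta>: "\<beta> \<in> brauer m n"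
    have \<alpha>\<beta>: "sandwich_mult m n \<sigma> \<alpha> \<beta> \<in> brauer m n" using sandwich_mult_closed[OF \<sigma> \<alpha> \<beta>] .
    show "sandwich_mult m n \<sigma> (sandwich_mult m n \<sigma> \<alpha> \<beta>) \<alpha> = \<alpha>"
    proof (rule brauer_completion_unique[OF sandwich_mult_closed[OF \<sigma> \<alpha>\<beta> \<alpha>] \<alpha> \<alpha> _ _ \<alpha>])
      show "upper_hooks \<alpha> \<subseteq> upper_hooks (sandwich_mult m n \<sigma> (sandwich_mult m n \<sigma> \<alpha> \<beta>) \<alpha>)"
        using upper_hooks_sandwich[OF \<sigma> \<alpha> \<beta>] upper_hooks_sandwich[OF \<sigma> \<alpha>\<beta> \<alpha>] by blast
      show "lower_hooks \<alpha> \<subseteq> lower_hooks (sandwich_mult m n \<sigma> (sandwich_mult m n \<sigma> \<alpha> \<beta>) \<alpha>)"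
        by (rule lower_hooks_sandwich[OF \<sigma> \<alpha>\<beta> \<alpha>])
    qed (use rank in auto)
  qed
next
  assume *: "\<forall>\<beta>\<in>brauer m n. sandwich_mult m n \<sigma> (sandwich_mult m n \<sigma> \<alpha> \<beta>) \<alpha> = \<alpha>"
  have parity: "m mod 2 = n mod 2" using brauer_rank_bounds(3,4)[OF \<alpha>] by simp
  obtain \<beta> where \<beta>: "\<beta> \<in> brauer m n" "brauer_rank m n \<beta> \<le> 1"
    using ex_brauer_of_rank_le_1[OF parity] .
  have \<alpha>\<beta>: "sandwich_mult m n \<sigma> \<alpha> \<beta> \<in> brauer m n" using sandwich_mult_closed[OF \<sigma> \<alpha> \<beta>(1)] .
  have "brauer_rank m n \<alpha> \<le> brauer_rank m n (sandwich_mult m n \<sigma> \<alpha> \<beta>)"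
    using brauer_rank_sandwich_le(1)[OF \<sigma> \<alpha>\<beta> \<alpha>] * \<beta>(1) by simp
  also have "\<dots> \<le> brauer_rank m n \<beta>" by (rule brauer_rank_sandwich_le(2)[OF \<sigma> \<alpha> \<beta>(1)])
  finally show "brauer_rank m n \<alpha> \<le> 1" using \<beta>(2) by simp
qed

text \<open>The right ideal generated by an element of rank at most one consists of all elements sharing its
  upper hooks, and the left ideal of all elements sharing its lower hooks. In both cases the uncovered
  vertices can be matched arbitrarily.\<close>
lemma card_right_ideal:
  assumes \<sigma>: "\<sigma> \<in> brauer n m" and \<alpha>: "\<alpha> \<in> brauer m n" and rank: "brauer_rank m n \<alpha> \<le> 1"
  shows "card (sandwich_mult m n \<sigma> \<alpha> ` brauer m n) = num_matchings (n + n mod 2)"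
proof -
  have "sandwich_mult m n \<sigma> \<alpha> ` brauer m n = {\<gamma> \<in> brauer m n. upper_hooks \<alpha> \<subseteq> \<gamma>}"
  proof (intro equalityI subsetI)
    fix \<gamma> assume "\<gamma> \<in> sandwich_mult m n \<sigma> \<alpha> ` brauer m n"
    then obtain \<beta> where \<beta>: "\<beta> \<in> brauer m n" "\<gamma> = sandwich_mult m n \<sigma> \<alpha> \<beta>" by blast
    have "upper_hooks \<alpha> \<subseteq> upper_hooks \<gamma>" using upper_hooks_sandwich[OF \<sigma> \<alpha> \<beta>(1)] \<beta>(2) by simp
    then show "\<gamma> \<in> {\<gamma> \<in> brauer m n. upper_hooks \<alpha> \<subseteq> \<gamma>}"
      using sandwich_mult_closed[OF \<sigma> \<alpha> \<beta>(1)] \<beta>(2) by (auto simp: upper_hooks_def)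
  next
    fix \<gamma> assume "\<gamma> \<in> {\<gamma> \<in> brauer m n. upper_hooks \<alpha> \<subseteq> \<gamma>}"
    then have \<gamma>: "\<gamma> \<in> brauer m n" and sub: "upper_hooks \<alpha> \<subseteq> upper_hooks \<gamma>"
      by (auto simp: upper_hooks_def)
    have "\<gamma> = sandwich_mult m n \<sigma> \<alpha> \<gamma>"
    proof (rule brauer_completion_unique[OF \<gamma> sandwich_mult_closed[OF \<sigma> \<alpha> \<gamma>] \<alpha> sub _ \<gamma>])
      show "brauer_rank m n \<alpha> + brauer_rank m n \<gamma> \<le> 2"
        using brauer_rank_antimono_upper[OF \<alpha> \<gamma> sub] rank by linarith
    qed (use upper_hooks_sandwich[OF \<sigma> \<alpha> \<gamma>] lower_hooks_sandwich[OF \<sigma> \<alpha> \<gamma>] in auto)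
    then show "\<gamma> \<in> sandwich_mult m n \<sigma> \<alpha> ` brauer m n" using \<gamma> by blast
  qed
  moreover have "card {\<gamma> \<in> brauer m n. upper_hooks \<alpha> \<subseteq> \<gamma>} = num_matchings (m + n - 2 * card (upper_hooks \<alpha>))"
  proof -
    have \<alpha>': "\<alpha> \<in> matchings (vertices m n)" using \<alpha> by (simp add: brauer_eq_matchings)
    have "upper_hooks \<alpha> \<in> matchings (\<Union>(upper_hooks \<alpha>))" "\<Union>(upper_hooks \<alpha>) \<subseteq> vertices m n"
      using matchings_subfamily[OF \<alpha>' hooks_basics(1)[OF \<alpha>]] hooks_basics(1)[OF \<alpha>] matchings_Union[OF \<alpha>']
      by blast+
    from card_matchings_containing[OF finite_vertices this] show ?thesis
      by (simp add: brauer_eq_matchings card_vertices)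
  qed
  moreover have "m + n - 2 * card (upper_hooks \<alpha>) = n + n mod 2"
  proof -
    have "brauer_rank m n \<alpha> = n mod 2" using rank brauer_rank_bounds(4)[OF \<alpha>] by presburger
    then show ?thesis using card_upper_hooks[OF \<alpha>] by linarith
  qed
  ultimately show ?thesis by simp
qed

lemma card_left_ideal:
  assumes \<sigma>: "\<sigma> \<in> brauer n m" and \<beta>: "\<beta> \<in> brauer m n" and rank: "brauer_rank m n \<beta> \<le> 1"
  shows "card ((\<lambda>\<alpha>. sandwich_mult m n \<sigma> \<alpha> \<beta>) ` brauer m n) = num_matchings (m + m mod 2)"
proof -
  have "(\<lambda>\<alpha>. sandwich_mult m n \<sigma> \<alpha> \<beta>) ` brauer m n = {\<gamma> \<in> brauer m n. lower_hooks \<beta> \<subseteq> \<gamma>}"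
  proof (intro equalityI subsetI)
    fix \<gamma> assume "\<gamma> \<in> (\<lambda>\<alpha>. sandwich_mult m n \<sigma> \<alpha> \<beta>) ` brauer m n"
    then obtain \<alpha> where \<alpha>: "\<alpha> \<in> brauer m n" "\<gamma> = sandwich_mult m n \<sigma> \<alpha> \<beta>" by blast
    have "lower_hooks \<beta> \<subseteq> lower_hooks \<gamma>" using lower_hooks_sandwich[OF \<sigma> \<alpha>(1) \<beta>] \<alpha>(2) by simp
    then show "\<gamma> \<in> {\<gamma> \<in> brauer m n. lower_hooks \<beta> \<subseteq> \<gamma>}"
      using sandwich_mult_closed[OF \<sigma> \<alpha>(1) \<beta>] \<alpha>(2) by (auto simp: lower_hooks_def)
  next
    fix \<gamma> assume "\<gamma> \<in> {\<gamma> \<in> brauer m n. lower_hooks \<beta> \<subseteq> \<gamma>}"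
    then have \<gamma>: "\<gamma> \<in> brauer m n" and sub: "lower_hooks \<beta> \<subseteq> lower_hooks \<gamma>"
      by (auto simp: lower_hooks_def)
    have "\<gamma> = sandwich_mult m n \<sigma> \<gamma> \<beta>"
    proof (rule brauer_completion_unique[OF \<gamma> sandwich_mult_closed[OF \<sigma> \<gamma> \<beta>] \<gamma> _ _ \<beta> sub])
      show "brauer_rank m n \<gamma> + brauer_rank m n \<beta> \<le> 2"
        using brauer_rank_antimono_lower[OF \<beta> \<gamma> sub] rank by linarith
    qed (use upper_hooks_sandwich[OF \<sigma> \<gamma> \<beta>] lower_hooks_sandwich[OF \<sigma> \<gamma> \<beta>] in auto)
    then show "\<gamma> \<in> (\<lambda>\<alpha>. sandwich_mult m n \<sigma> \<alpha> \<beta>) ` brauer m n" using \<gamma> by blast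
  qed
  moreover have "card {\<gamma> \<in> brauer m n. lower_hooks \<beta> \<subseteq> \<gamma>} = num_matchings (m + n - 2 * card (lower_hooks \<beta>))"
  proof -
    have \<beta>': "\<beta> \<in> matchings (vertices m n)" using \<beta> by (simp add: brauer_eq_matchings)
    have "lower_hooks \<beta> \<in> matchings (\<Union>(lower_hooks \<beta>))" "\<Union>(lower_hooks \<beta>) \<subseteq> vertices m n"
      using matchings_subfamily[OF \<beta>' hooks_basics(2)[OF \<beta>]] hooks_basics(2)[OF \<beta>] matchings_Union[OF \<beta>']
      by blast+
    from card_matchings_containing[OF finite_vertices this] show ?thesis
      by (simp add: brauer_eq_matchings card_vertices)
  qed
  moreover have "m + n - 2 * card (lower_hooks \<beta>) = m + m mod 2"
  proof -
    have "brauer_rank m n \<beta> = m mod 2" using rank brauer_rank_bounds(3)[OF \<beta>] by presburger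
    then show ?thesis using card_lower_hooks[OF \<beta>] by linarith
  qed
  ultimately show ?thesis by simp
qed

text \<open>If \<open>n \<le> 1\<close>, then all ranks are at most one and there are no lower hooks, so an element is determined
  by its upper hooks; dually for \<open>m \<le> 1\<close>.\<close>
lemma sandwich_left_zero:
  assumes "\<sigma> \<in> brauer n m" "\<alpha> \<in> brauer m n" "\<beta> \<in> brauer m n" "n \<le> 1"
  shows "sandwich_mult m n \<sigma> \<alpha> \<beta> = \<alpha>"
proof (rule brauer_completion_unique[OF sandwich_mult_closed[OF assms(1-3)] assms(2) assms(2) _ _ assms(2)])
  have "card (lower_hooks \<alpha>) = 0" using card_lower_hooks[OF assms(2)] assms(4) by linarith
  then have "lower_hooks \<alpha> = {}" using hooks_basics(5)[OF assms(2)] by simp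
  then show "lower_hooks \<alpha> \<subseteq> lower_hooks (sandwich_mult m n \<sigma> \<alpha> \<beta>)" by simp
  show "brauer_rank m n \<alpha> + brauer_rank m n \<alpha> \<le> 2" using brauer_rank_bounds(2)[OF assms(2)] assms(4) by linarith
qed (use upper_hooks_sandwich[OF assms(1-3)] in auto)

lemma sandwich_right_zero:
  assumes "\<sigma> \<in> brauer n m" "\<alpha> \<in> brauer m n" "\<beta> \<in> brauer m n" "m \<le> 1"
  shows "sandwich_mult m n \<sigma> \<alpha> \<beta> = \<beta>"
proof (rule brauer_completion_unique[OF sandwich_mult_closed[OF assms(1-3)] assms(3) assms(3) _ _ assms(3)])
  have "card (upper_hooks \<beta>) = 0" using card_upper_hooks[OF assms(3)] assms(4) by linarith
  then have "upper_hooks \<beta> = {}" using hooks_basics(4)[OF assms(3)] by simp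
  then show "upper_hooks \<beta> \<subseteq> upper_hooks (sandwich_mult m n \<sigma> \<alpha> \<beta>)" by simp
  show "brauer_rank m n \<beta> + brauer_rank m n \<beta> \<le> 2" using brauer_rank_bounds(1)[OF assms(3)] assms(4) by linarith
qed (use lower_hooks_sandwich[OF assms(1-3)] in auto)

section \<open>Isomorphisms\<close>

lemma left_zero_semigroups_isomorphic:
  assumes "finite S" "finite T" "card S = card T"
    and "\<And>x y. x \<in> S \<Longrightarrow> y \<in> S \<Longrightarrow> f x y = x" "\<And>x y. x \<in> T \<Longrightarrow> y \<in> T \<Longrightarrow> g x y = x"
  shows "semigroups_isomorphic S f T g"
proof -
  obtain \<phi> where "bij_betw \<phi> S T" using finite_same_card_bij assms(1-3) by blast
  then show ?thesis
    unfolding semigroups_isomorphic_def using assms(4,5) by (metis bij_betwE)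
qed

lemma right_zero_semigroups_isomorphic:
  assumes "finite S" "finite T" "card S = card T"
    and "\<And>x y. x \<in> S \<Longrightarrow> y \<in> S \<Longrightarrow> f x y = y" "\<And>x y. x \<in> T \<Longrightarrow> y \<in> T \<Longrightarrow> g x y = y"
  shows "semigroups_isomorphic S f T g"
proof -
  obtain \<phi> where "bij_betw \<phi> S T" using finite_same_card_bij assms(1-3) by blast
  then show ?thesis
    unfolding semigroups_isomorphic_def using assms(4,5) by (metis bij_betwE)
qed

lemma trivial_semigroups_isomorphic:
  assumes "card S = 1" "card T = 1"
    and "\<And>x y. x \<in> S \<Longrightarrow> y \<in> S \<Longrightarrow> f x y \<in> S" "\<And>x y. x \<in> T \<Longrightarrow> y \<in> T \<Longrightarrow> g x y \<in> T"
  shows "semigroups_isomorphic S f T g"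
proof (rule left_zero_semigroups_isomorphic)
  show "finite S" "finite T" using assms(1,2) card.infinite by fastforce+
  show "f x y = x" if "x \<in> S" "y \<in> S" for x y
    using that assms(1,3) by (metis card_1_singletonE singletonD)
  show "g x y = x" if "x \<in> T" "y \<in> T" for x y
    using that assms(2,4) by (metis card_1_singletonE singletonD)
qed (use assms in simp)

text \<open>The numerical invariants: the sizes of the semigroup, of the left and right ideals generated by an
  element of the minimal ideal, and of the set of all products.\<close>
lemma isomorphic_sandwich_invariants:
  assumes \<sigma>: "\<sigma> \<in> brauer n m" and \<tau>: "\<tau> \<in> brauer l k" and parity: "m mod 2 = n mod 2"
    and iso: "semigroups_isomorphic (brauer m n) (sandwich_mult m n \<sigma>) (brauer k l) (sandwich_mult k l \<tau>)"
  shows "num_matchings (m + n) = num_matchings (k + l)"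
    and "num_matchings (m + m mod 2) = num_matchings (k + k mod 2)"
    and "num_matchings (n + n mod 2) = num_matchings (l + l mod 2)"
    and "card {\<gamma> \<in> brauer m n. brauer_rank m n \<gamma> \<le> brauer_rank n m \<sigma>}
       = card {\<gamma> \<in> brauer k l. brauer_rank k l \<gamma> \<le> brauer_rank l k \<tau>}"
proof -
  let ?S = "brauer m n" and ?T = "brauer k l"
    and ?f = "sandwich_mult m n \<sigma>" and ?g = "sandwich_mult k l \<tau>"
  obtain \<phi> where \<phi>: "bij_betw \<phi> ?S ?T" and hom: "\<And>x y. x \<in> ?S \<Longrightarrow> y \<in> ?S \<Longrightarrow> \<phi> (?f x y) = ?g (\<phi> x) (\<phi> y)"
    using iso unfolding semigroups_isomorphic_def by blast
  have inj: "inj_on \<phi> ?S" and surj: "\<phi> ` ?S = ?T" using \<phi> by (simp_all add: bij_betw_def)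
  have card_image_\<phi>: "card (\<phi> ` X) = card X" if "X \<subseteq> ?S" for X
    using inj that by (metis card_image inj_on_subset)
  show "num_matchings (m + n) = num_matchings (k + l)"
    using bij_betw_same_card[OF \<phi>] by (simp add: card_brauer)
  obtain \<alpha> where \<alpha>: "\<alpha> \<in> ?S" "brauer_rank m n \<alpha> \<le> 1" using ex_brauer_of_rank_le_1[OF parity] .
  have \<phi>\<alpha>: "\<phi> \<alpha> \<in> ?T" using surj \<alpha>(1) by blast
  have "?g (?g (\<phi> \<alpha>) \<beta>) (\<phi> \<alpha>) = \<phi> \<alpha>" if "\<beta> \<in> ?T" for \<beta>
  proof -
    obtain \<beta>' where \<beta>': "\<beta>' \<in> ?S" "\<beta> = \<phi> \<beta>'" using \<open>\<beta> \<in> ?T\<close> surj by blast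
    have "?f (?f \<alpha> \<beta>') \<alpha> = \<alpha>" using sandwich_low_rank_iff[OF \<sigma> \<alpha>(1)] \<alpha>(2) \<beta>'(1) by blast
    then show ?thesis
      using hom[OF sandwich_mult_closed[OF \<sigma> \<alpha>(1) \<beta>'(1)] \<alpha>(1)] hom[OF \<alpha>(1) \<beta>'(1)] \<beta>'(2) by simp
  qed
  then have rank: "brauer_rank k l (\<phi> \<alpha>) \<le> 1" using sandwich_low_rank_iff[OF \<tau> \<phi>\<alpha>] by blast
  have "\<phi> ` (\<lambda>x. ?f x \<alpha>) ` ?S = (\<lambda>x. ?g x (\<phi> \<alpha>)) ` \<phi> ` ?S"
    unfolding image_image using hom \<alpha>(1) by (intro image_cong) auto
  then have "card ((\<lambda>x. ?f x \<alpha>) ` ?S) = card ((\<lambda>x. ?g x (\<phi> \<alpha>)) ` ?T)"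
    using card_image_\<phi>[of "(\<lambda>x. ?f x \<alpha>) ` ?S"] sandwich_mult_closed[OF \<sigma> _ \<alpha>(1)] surj
    by (metis image_subsetI)
  then show "num_matchings (m + m mod 2) = num_matchings (k + k mod 2)"
    using card_left_ideal[OF \<sigma> \<alpha>] card_left_ideal[OF \<tau> \<phi>\<alpha> rank] by simp
  have "\<phi> ` ?f \<alpha> ` ?S = ?g (\<phi> \<alpha>) ` \<phi> ` ?S"
    unfolding image_image using hom \<alpha>(1) by (intro image_cong) auto
  then have "card (?f \<alpha> ` ?S) = card (?g (\<phi> \<alpha>) ` ?T)"
    using card_image_\<phi>[of "?f \<alpha> ` ?S"] sandwich_mult_closed[OF \<sigma> \<alpha>(1)] surj
    by (metis image_subsetI)
  then show "num_matchings (n + n mod 2) = num_matchings (l + l mod 2)"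
    using card_right_ideal[OF \<sigma> \<alpha>] card_right_ideal[OF \<tau> \<phi>\<alpha> rank] by simp
  have "\<phi> ` (\<lambda>(x, y). ?f x y) ` (?S \<times> ?S) = (\<lambda>(x, y). ?g x y) ` (?T \<times> ?T)"
    using hom surj[symmetric] by (force simp: image_iff)
  moreover have "(\<lambda>(x, y). ?f x y) ` (?S \<times> ?S) \<subseteq> ?S" using sandwich_mult_closed[OF \<sigma>] by auto
  ultimately show "card {\<gamma> \<in> ?S. brauer_rank m n \<gamma> \<le> brauer_rank n m \<sigma>}
       = card {\<gamma> \<in> ?T. brauer_rank k l \<gamma> \<le> brauer_rank l k \<tau>}"
    using card_image_\<phi>[of "(\<lambda>(x, y). ?f x y) ` (?S \<times> ?S)"]
    unfolding sandwich_products[OF \<sigma>] sandwich_products[OF \<tau>] by simp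
qed

text \<open>The number of products grows strictly with the rank of the sandwich element.\<close>
lemma card_rank_le_strict_mono:
  assumes "\<tau> \<in> brauer n m" "r < brauer_rank n m \<tau>"
  shows "card {\<gamma> \<in> brauer m n. brauer_rank m n \<gamma> \<le> r}
    < card {\<gamma> \<in> brauer m n. brauer_rank m n \<gamma> \<le> brauer_rank n m \<tau>}"
proof (rule psubset_card_mono)
  show "finite {\<gamma> \<in> brauer m n. brauer_rank m n \<gamma> \<le> brauer_rank n m \<tau>}" using finite_brauer by simp
  obtain \<gamma> where "\<gamma> \<in> brauer m n" "brauer_rank m n \<gamma> = brauer_rank n m \<tau>"
    using ex_brauer_of_rank[OF assms(1)] .
  with assms(2) show "{\<gamma> \<in> brauer m n. brauer_rank m n \<gamma> \<le> r}
    \<subset> {\<gamma> \<in> brauer m n. brauer_rank m n \<gamma> \<le> brauer_rank n m \<tau>}" by force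
qed

theorem theorem6p4:
  fixes m n k l r s :: nat and \<sigma> \<tau> :: "vertex set set"
  assumes "m mod 2 = n mod 2" and "k mod 2 = l mod 2"
    and "\<sigma> \<in> brauer n m" and "\<tau> \<in> brauer l k"
    and "r = brauer_rank n m \<sigma>" and "s = brauer_rank l k \<tau>"
  shows "semigroups_isomorphic (brauer m n) (sandwich_mult m n \<sigma>)
           (brauer k l) (sandwich_mult k l \<tau>) \<longleftrightarrow>
      (m, n, r) = (k, l, s)
    \<or> (m + n \<le> 2 \<and> k + l \<le> 2)
    \<or> (\<exists>q::nat. q > 0 \<and>
         ((m, n, r) = (2 * q, 0, 0) \<and> (k, l, s) = (2 * q - 1, 1, 1)
        \<or> (k, l, s) = (2 * q, 0, 0) \<and> (m, n, r) = (2 * q - 1, 1, 1)))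
    \<or> (\<exists>q::nat. q > 0 \<and>
         ((m, n, r) = (0, 2 * q, 0) \<and> (k, l, s) = (1, 2 * q - 1, 1)
        \<or> (k, l, s) = (0, 2 * q, 0) \<and> (m, n, r) = (1, 2 * q - 1, 1)))"
    (is "?iso \<longleftrightarrow> ?same \<or> ?small \<or> ?left \<or> ?right")
proof
  assume iso: ?iso
  note inv = isomorphic_sandwich_invariants[OF assms(3,4,1) iso]
  have "even (m + n)" "even (k + l)" using assms(1,2) by presburger+
  then have size: "m + n = k + l \<or> ?small" using num_matchings_eqD[OF inv(1)] by simp
  have m: "m + m mod 2 = k + k mod 2 \<or> m + m mod 2 \<le> 2 \<and> k + k mod 2 \<le> 2"
    by (rule num_matchings_eqD[OF inv(2)]) presburger+
  have n: "n + n mod 2 = l + l mod 2 \<or> n + n mod 2 \<le> 2 \<and> l + l mod 2 \<le> 2"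
    by (rule num_matchings_eqD[OF inv(3)]) presburger+
  have r: "r \<le> m" "r \<le> n" "r mod 2 = m mod 2" "r mod 2 = n mod 2"
    using brauer_rank_bounds[OF assms(3)] assms(5) by simp_all
  have s: "s \<le> k" "s \<le> l" "s mod 2 = k mod 2" "s mod 2 = l mod 2"
    using brauer_rank_bounds[OF assms(4)] assms(6) by simp_all
  have same_rank: "r = s" if eq: "m = k" "n = l"
  proof (rule ccontr)
    assume "r \<noteq> s"
    then consider "r < s" | "s < r" by linarith
    then show False
    proof cases
      case 1
      then show False using card_rank_le_strict_mono[of \<tau> n m r] inv(4) assms(4-6) eq by simp
    next
      case 2
      then show False using card_rank_le_strict_mono[of \<sigma> n m s] inv(4) assms(3,5,6) eq by simp
    qed
  qed
  show "?same \<or> ?small \<or> ?left \<or> ?right"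
  proof (cases ?small)
    case False
    \<comment> \<open>Besides \<open>m + n\<close>, the invariants determine \<open>m\<close> and \<open>n\<close> up to rounding up to an even
        number and identifying \<open>0\<close> with \<open>2\<close>.\<close>
    have "m = k \<and> n = l \<or> m = k + 1 \<and> n = 0 \<and> l = 1 \<or> k = m + 1 \<and> l = 0 \<and> n = 1
      \<or> n = l + 1 \<and> m = 0 \<and> k = 1 \<or> l = n + 1 \<and> k = 0 \<and> m = 1"
    proof -
      obtain a b c d z w where mn: "m = 2 * a + z" "n = 2 * b + z" "z = 0 \<or> z = 1" "z = m mod 2"
        and kl: "k = 2 * c + w" "l = 2 * d + w" "w = 0 \<or> w = 1" "w = k mod 2"
        using assms(1,2) by (metis div_mult_mod_eq mult.commute not_mod_2_eq_0_eq_1)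
      have 1: "a + z = c + w \<or> a + z \<le> 1 \<and> c + w \<le> 1"
        using m mn(1,4) kl(1,4) by linarith
      have 2: "b + z = d + w \<or> b + z \<le> 1 \<and> d + w \<le> 1"
        using n assms(1,2) mn(2,4) kl(2,4) by linarith
      have 3: "a + b + z = c + d + w" "a + b + z > 1"
        using size False mn(1,2) kl(1,2) by linarith+
      show ?thesis
        using mn(3) kl(3) unfolding mn(1,2) kl(1,2)
        by (elim disjE; use 1 2 3 in simp; linarith)
    qed
    then consider "m = k" "n = l" | "m = k + 1" "n = 0" "l = 1" | "k = m + 1" "l = 0" "n = 1"
      | "n = l + 1" "m = 0" "k = 1" | "l = n + 1" "k = 0" "m = 1"
      by blast
    then show ?thesis
    proof cases
      case 1
      then show ?thesis using same_rank by simp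
    next
      case 2
      have "m mod 2 = 0" using assms(1) 2 by simp
      then obtain q where "m = 2 * q" by fastforce
      moreover have "r = 0" using r(2) 2 by simp
      moreover have "s = 1"
      proof -
        have "s \<le> 1" "s mod 2 = 1" using s(2,4) 2 by simp_all
        then show ?thesis by (cases s) auto
      qed
      ultimately have ?left using 2 by (intro exI[of _ q]) auto
      then show ?thesis by blast
    next
      case 3
      have "k mod 2 = 0" using assms(2) 3 by simp
      then obtain q where "k = 2 * q" by fastforce
      moreover have "s = 0" using s(2) 3 by simp
      moreover have "r = 1"
      proof -
        have "r \<le> 1" "r mod 2 = 1" using r(2,4) 3 by simp_all
        then show ?thesis by (cases r) auto
      qed
      ultimately have ?left using 3 by (intro exI[of _ q]) auto
      then show ?thesis by blast
    next
      case 4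
      have "n mod 2 = 0" using assms(1) 4 by simp
      then obtain q where "n = 2 * q" by fastforce
      moreover have "r = 0" using r(1) 4 by simp
      moreover have "s = 1"
      proof -
        have "s \<le> 1" "s mod 2 = 1" using s(1,3) 4 by simp_all
        then show ?thesis by (cases s) auto
      qed
      ultimately have ?right using 4 by (intro exI[of _ q]) auto
      then show ?thesis by blast
    next
      case 5
      have "l mod 2 = 0" using assms(2) 5 by simp
      then obtain q where "l = 2 * q" by fastforce
      moreover have "s = 0" using s(1) 5 by simp
      moreover have "r = 1"
      proof -
        have "r \<le> 1" "r mod 2 = 1" using r(1,3) 5 by simp_all
        then show ?thesis by (cases r) auto
      qed
      ultimately have ?right using 5 by (intro exI[of _ q]) auto
      then show ?thesis by blast
    qed
  qed simp
next
  assume cases: "?same \<or> ?small \<or> ?left \<or> ?right"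
  \<comment> \<open>In the two exceptional families both semigroups are left zero, respectively right zero, semigroups
      of the same size.\<close>
  consider ?same | ?small | "n \<le> 1" "l \<le> 1" "m + n = k + l" | "m \<le> 1" "k \<le> 1" "m + n = k + l"
    using cases by auto
  then show ?iso
  proof cases
    case 1
    then have eq: "k = m" "l = n" "s = r" by simp_all
    have "\<tau> \<in> brauer n m" using assms(4) eq by simp
    moreover have "brauer_rank n m \<sigma> = brauer_rank n m \<tau>" using assms(5,6) eq by simp
    ultimately show ?thesis using sandwich_isomorphic_of_same_rank[OF assms(3)] eq by simp
  next
    case 2
    have "num_matchings i = 1" if "i \<le> 2" "even i" for i
    proof -
      have "i = 0 \<or> i = 2" using that by presburger
      then show ?thesis by (auto simp: numeral_2_eq_2)
    qed
    moreover have "even (m + n)" "even (k + l)" using assms(1,2) by presburger+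
    ultimately have "card (brauer m n) = 1" "card (brauer k l) = 1" using 2 by (simp_all add: card_brauer)
    then show ?thesis
      using sandwich_mult_closed assms(3,4) by (intro trivial_semigroups_isomorphic) auto
  next
    case 3
    then show ?thesis
      using sandwich_left_zero assms(3,4) by (intro left_zero_semigroups_isomorphic) (auto simp: card_brauer finite_brauer)
  next
    case 4
    then show ?thesis
      using sandwich_right_zero assms(3,4) by (intro right_zero_semigroups_isomorphic) (auto simp: card_brauer finite_brauer)
  qed
qed

end
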